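(* Let $G$ be a graph with $V(G)=[n]$, and let $W_G$ be its whisker graph. Then $\mathrm{v}_\emptyset(J_{W_G})=n\le \mathrm{reg}(S/J_{W_G})$.
   Context: All graphs are finite and simple, and $[n]=\{1,\dots,n\}$. The whisker graph $W_G$ of a graph $G$ with $V(G)=\{v_1,\dots,v_n\}$ has vertex set $\{v_1,\dots,v_n,u_1,\dots,u_n\}$ (with $u_1,\dots,u_n$ new vertices) and edge set $E(G)\cup\{\{v_i,u_i\}\mid i=1,\dots,n\}$. Let $K$ be a field. For a graph $H$ with (totally ordered) vertex set $V(H)$, put $S=K[x_i,y_i\mid i\in V(H)]$ with the standard grading, $f_{ij}=x_iy_j-x_jy_i$, and $J_H=\langle f_{ij}\mid\{i,j\}\in E(H),\ i<j\rangle$ (the binomial edge ideal of $H$); in the claim $H=W_G$. Let $P_\emptyset(H)$ be the ideal generated by all $f_{ij}$ with $i<j$ in the same connected component of $H$; it is an associated prime of $J_H$. Then $\mathrm{v}_\emptyset(J_H)=\min\{d\ge 0\mid\exists f\in S_d\text{ with }(J_H:f)=P_\emptyset(H)\}$, where $S_d$ is the degree $d$ component of $S$. $\mathrm{reg}$ denotes Castelnuovo–Mumford regularity.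
   Formalization: The equality v_∅(J_{W_G}) = n is proved only for G without isolated vertices, since it fails otherwise (for n = 1, J_{W_G} = P_∅ and the v-number is 0); the bound n ≤ reg(S/J_{W_G}) is proved for every G. *)

theory Defs
  imports
    "HOL-Library.Cardinality"
    "HOL-Library.Poly_Mapping"
    "HOL-Library.Extended_Real"
    "Jordan_Normal_Form.Matrix_Kernel"
begin

section \<open>Graphs\<close>

text \<open>A graph has as vertices all elements of a type; it is given by its set of edges.\<close>

definition simple_graph :: "'v set set \<Rightarrow> bool" where
  "simple_graph E \<longleftrightarrow> (\<forall>e\<in>E. card e = 2)"

definition same_component :: "'v set set \<Rightarrow> 'v \<Rightarrow> 'v \<Rightarrow> bool" where
  "same_component E i j \<longleftrightarrow> (i, j) \<in> {(a, b). {a, b} \<in> E}\<^sup>*"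

text \<open>If $v$ is isolated in $G$, then $\{v, u\}$ is a component $K_2$ of the whisker graph and
  contributes a prime summand to the binomial edge ideal. Such vertices do not count for the
  v-number: for $G$ a single vertex, $(J : 1) = J = P_\emptyset$ has v-number 0.\<close>

definition isolated_vertex :: "'v set set \<Rightarrow> 'v \<Rightarrow> bool" where
  "isolated_vertex E i \<longleftrightarrow> (\<forall>e\<in>E. i \<notin> e)"

text \<open>The vertices of the whisker graph: \<open>Orig i\<close> is $v_i$, \<open>Leaf i\<close> is $u_i$, ordered as
  $v_1 < \dots < v_n < u_1 < \dots < u_n$.\<close>

datatype 'a whisker_vertex = Orig 'a | Leaf 'a

instance whisker_vertex :: (finite) finite
proof
  have "(UNIV :: 'a whisker_vertex set) = range Orig \<union> range Leaf"
    by (metis UNIV_eq_I UnI1 UnI2 rangeI whisker_vertex.exhaust)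
  then show "finite (UNIV :: 'a whisker_vertex set)" by (metis finite finite_Un finite_imageI)
qed

instantiation whisker_vertex :: (linorder) linorder
begin

fun less_eq_whisker_vertex :: "'a whisker_vertex \<Rightarrow> 'a whisker_vertex \<Rightarrow> bool" where
  "Orig i \<le> Orig j \<longleftrightarrow> i \<le> j"
| "Orig i \<le> Leaf j \<longleftrightarrow> True"
| "Leaf i \<le> Orig j \<longleftrightarrow> False"
| "Leaf i \<le> Leaf j \<longleftrightarrow> i \<le> j"

definition less_whisker_vertex :: "'a whisker_vertex \<Rightarrow> 'a whisker_vertex \<Rightarrow> bool" where
  "less_whisker_vertex p q \<longleftrightarrow> p \<le> q \<and> \<not> q \<le> p"

instance
proof
  fix p q r :: "'a whisker_vertex"
  show "p < q \<longleftrightarrow> p \<le> q \<and> \<not> q \<le> p" by (rule less_whisker_vertex_def)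
  show "p \<le> p" by (cases p) auto
  show "p \<le> q \<Longrightarrow> q \<le> r \<Longrightarrow> p \<le> r" by (cases p; cases q; cases r) auto
  show "p \<le> q \<Longrightarrow> q \<le> p \<Longrightarrow> p = q" by (cases p; cases q) auto
  show "p \<le> q \<or> q \<le> p" by (cases p; cases q) auto
qed

end

definition whisker_graph :: "'a set set \<Rightarrow> 'a whisker_vertex set set" where
  "whisker_graph E = (\<lambda>e. Orig ` e) ` E \<union> range (\<lambda>i. {Orig i, Leaf i})"


section \<open>The polynomial ring\<close>

datatype 'v var = X 'v | Y 'v

text \<open>$S = K[x_i, y_i \mid i \in V(H)]$, where $V(H)$ is the type \<open>'v\<close>: a polynomial maps
  exponent vectors to coefficients.\<close>

type_synonym ('v, 'k) polyring = "('v var \<Rightarrow>\<^sub>0 nat) \<Rightarrow>\<^sub>0 'k"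

definition indet :: "'v var \<Rightarrow> ('v, 'k::field) polyring" where
  "indet z = Poly_Mapping.single (Poly_Mapping.single z 1) 1"

definition monom_degree :: "('v var \<Rightarrow>\<^sub>0 nat) \<Rightarrow> nat" where
  "monom_degree m = (\<Sum>z\<in>Poly_Mapping.keys m. Poly_Mapping.lookup m z)"

text \<open>The homogeneous component $S_d$; it is zero for $d < 0$.\<close>

definition graded_part :: "int \<Rightarrow> ('v, 'k::field) polyring set" where
  "graded_part d = {p. \<forall>m\<in>Poly_Mapping.keys p. int (monom_degree m) = d}"

abbreviation ideal_gen :: "('v, 'k::field) polyring set \<Rightarrow> ('v, 'k) polyring set" where
  "ideal_gen B \<equiv> Modules.module.span (*) B"

definition colon :: "('v, 'k::field) polyring set \<Rightarrow> ('v, 'k) polyring \<Rightarrow> ('v, 'k) polyring set" where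
  "colon I f = {g. g * f \<in> I}"

definition irrelevant_ideal :: "('v, 'k::field) polyring set" where
  "irrelevant_ideal = ideal_gen (range indet)"


section \<open>Binomial edge ideals and the local v-number at the empty set\<close>

definition edge_binomial :: "'v \<Rightarrow> 'v \<Rightarrow> ('v, 'k::field) polyring" where
  "edge_binomial i j = indet (X i) * indet (Y j) - indet (X j) * indet (Y i)"

definition binomial_edge_ideal :: "'v::linorder set set \<Rightarrow> ('v, 'k::field) polyring set" where
  "binomial_edge_ideal E = ideal_gen {edge_binomial i j | i j. {i, j} \<in> E \<and> i < j}"

definition P_empty :: "'v::linorder set set \<Rightarrow> ('v, 'k::field) polyring set" where
  "P_empty E = ideal_gen {edge_binomial i j | i j. i < j \<and> same_component E i j}"

text \<open>The type argument selects the coefficient field.\<close>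

definition v_empty :: "'k::field itself \<Rightarrow> 'v::linorder set set \<Rightarrow> nat" where
  "v_empty _ E = (LEAST d. \<exists>f :: ('v, 'k) polyring. f \<in> graded_part (int d) \<and>
     colon (binomial_edge_ideal E) f = P_empty E)"


section \<open>Castelnuovo--Mumford regularity\<close>

text \<open>A minimal graded free resolution
  $\cdots \to F_2 \to F_1 \to F_0 \to S/I \to 0$, where $F_i = \bigoplus_b S(-D_{i,b})$ with
  \<open>D i\<close> the list of the degrees of a homogeneous basis, \<open>\<phi> i\<close> is the matrix of
  $F_{i+1} \to F_i$, and $F_0 \to S/I$ sends the basis element number \<open>b\<close> to the class of
  \<open>\<epsilon> $ b\<close>. The clauses say, in this order: the shapes; all maps are homogeneous of degree 0;
  surjectivity onto $S/I$; exactness at $F_0$; exactness at $F_{i+1}$; minimality.\<close>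

definition minimal_graded_free_resolution ::
  "('v, 'k::field) polyring set \<Rightarrow> (nat \<Rightarrow> int list) \<Rightarrow> ('v, 'k) polyring vec \<Rightarrow>
   (nat \<Rightarrow> ('v, 'k) polyring mat) \<Rightarrow> bool" where
  "minimal_graded_free_resolution I D \<epsilon> \<phi> \<longleftrightarrow>
     \<epsilon> \<in> carrier_vec (length (D 0)) \<and>
     (\<forall>i. \<phi> i \<in> carrier_mat (length (D i)) (length (D (Suc i)))) \<and>
     (\<forall>b < length (D 0). \<epsilon> $ b \<in> graded_part (D 0 ! b)) \<and>
     (\<forall>i. \<forall>a < length (D i). \<forall>b < length (D (Suc i)).
        \<phi> i $$ (a, b) \<in> graded_part (D (Suc i) ! b - D i ! a)) \<and>
     (\<forall>p. \<exists>u \<in> carrier_vec (length (D 0)). p - \<epsilon> \<bullet> u \<in> I) \<and>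
     {u \<in> carrier_vec (length (D 0)). \<epsilon> \<bullet> u \<in> I} =
       (\<lambda>w. \<phi> 0 *\<^sub>v w) ` carrier_vec (length (D 1)) \<and>
     (\<forall>i. mat_kernel (\<phi> i) =
       (\<lambda>w. \<phi> (Suc i) *\<^sub>v w) ` carrier_vec (length (D (Suc (Suc i))))) \<and>
     (\<forall>i. \<forall>a < length (D i). \<forall>b < length (D (Suc i)). \<phi> i $$ (a, b) \<in> irrelevant_ideal)"

text \<open>$\beta_{i,j}(S/I)$: the number of summands $S(-j)$ in $F_i$. Minimal graded free resolutions
  are unique up to isomorphism, so the choice of the resolution does not matter.\<close>

definition graded_betti :: "('v, 'k::field) polyring set \<Rightarrow> nat \<Rightarrow> int \<Rightarrow> nat" where
  "graded_betti I i j =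
     count_list ((SOME D. \<exists>\<epsilon> \<phi>. minimal_graded_free_resolution I D \<epsilon> \<phi>) i) j"

text \<open>$\mathrm{reg}(S/I) = \max \{j - i \mid \beta_{i,j}(S/I) \neq 0\}$. The supremum is taken in the
  extended reals; for finitely many variables it is a maximum by Hilbert's syzygy theorem
  unless $S/I = 0$, where it is $-\infty$.\<close>

definition reg_quotient :: "('v, 'k::field) polyring set \<Rightarrow> ereal" where
  "reg_quotient I =
     (SUP (i, j) \<in> {(i, j). graded_betti I i j \<noteq> 0}. ereal (real_of_int (j - int i)))"

end

theory Submission
  imports Defs "HOL-Library.Function_Algebras" "HOL-Computational_Algebra.Primes"
begin

text \<open>Write $H = W_G$, $J = J_H$, $P = P_\emptyset(H)$, and $f_{pq} = x_p y_q - x_q y_p$.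

\<^bold>\<open>The v-number.\<close> $P$ is the kernel of the toric map $x_i \mapsto t_i a_c$, $y_i \mapsto t_i$,
where $c$ is the component of $i$ (\<open>toric_ideal_eq_kernel\<close>), so it is prime and contains no
product of variables. For the upper bound take $f = \prod_i x_{v_i}$. Two vertices $p, q$ of one
component are joined by a path whose inner vertices are distinct vertices $v_i$, and
$x_w f_{pq} = x_p f_{wq} + x_q f_{pw}$ shows step by step that the product of the inner $x_{v_i}$
times $f_{pq}$ lies in $J$ (\<open>path_edge_binomial\<close>). Hence $P \subseteq (J : f)$, and the other
inclusion holds because $J \subseteq P$ and $P$ is prime (\<open>colon_prod_Orig\<close>). For the lower
bound let $(J : f) = P$ with $f$ of degree $d$. Then $f \notin P$. Let $v_j$ be a neighbour of
$v_i$, which exists when $v_i$ is not isolated; then $f_{v_j u_i} f \in J$. Setting the two variables at $v_i$ to zero isolates $u_i$, so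
after this substitution one may use a toric map that gives $u_i$ a component of its own: it kills
$J$ but not $f_{v_j u_i}$, so it kills $f$. This says that the toric image of $f$ is divisible by
$t_{v_i}$. This holds for all $i$ and the image is not zero, so $d \ge n$
(\<open>degree_ge_of_colon_eq_P_empty\<close>).

\<^bold>\<open>The regularity.\<close> The $n$ quadrics $f_{v_i u_i} \in J$ act on
$T = S/(y_{v_i}, x_{u_i} \mid i) = K[x_{v_i}, y_{u_i} \mid i]$ as the regular sequence
$x_{v_i} y_{u_i}$, and $J$ annihilates $T/(x_{v_i} y_{u_i} \mid i)$. By a theorem of Rees,
$\mathrm{Ext}^n_S(S/J, T) \cong \mathrm{Hom}(S/J, T/(x_{v_i} y_{u_i} \mid i))(2n)$, which is not
zero in degree $-2n$. A cocycle of this degree is a nonzero map $F_n \to T$ of degree $-2n$ on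
the $n$-th module of the resolution, and it forces $F_n$ to have a generator of degree at least
$2n$. So some $\beta_{n,j}$ with $j - n \ge n$ is not zero. The dimension shifting behind Rees's theorem is
carried out on matrices in \<open>cocycle_is_coboundary\<close> and \<open>nontrivial_cocycle\<close>.

The Betti numbers are defined by choosing some minimal graded free resolution, so one has to
exist (\<open>minimal_graded_free_resolution_exists\<close>). Its modules are built one after the
other by choosing minimal homogeneous generators of the previous kernel; there are finitely many of them
by Hilbert's basis theorem, which is obtained from Dickson's lemma and a monomial order
(\<open>finitely_many_homogeneous_generators\<close>).\<close>

section \<open>Ideals and maps of monoid algebras\<close>

abbreviation lookup :: "('b \<Rightarrow>\<^sub>0 'c::zero) \<Rightarrow> 'b \<Rightarrow> 'c" where
  "lookup \<equiv> Poly_Mapping.lookup"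

lemma module_mult: "Modules.module ((*) :: 'r::comm_ring_1 \<Rightarrow> 'r \<Rightarrow> 'r)"
  by unfold_locales (simp_all add: algebra_simps)

lemmas ideal_gen_base = Modules.module.span_base[OF module_mult]
  and ideal_gen_zero = Modules.module.span_zero[OF module_mult]
  and ideal_gen_add = Modules.module.span_add[OF module_mult]
  and ideal_gen_neg = Modules.module.span_neg[OF module_mult]
  and ideal_gen_mono = Modules.module.span_mono[OF module_mult]
  and ideal_gen_scale = Modules.module.span_scale[OF module_mult]
  and ideal_gen_induct [consumes 1, case_names base step] = Modules.module.span_induct_alt[OF module_mult]

lemma ideal_gen_mult_left: "p \<in> ideal_gen B \<Longrightarrow> q * p \<in> ideal_gen B"
  by (rule ideal_gen_scale)

lemma poly_eq_sum_single: "p = (\<Sum>m\<in>Poly_Mapping.keys p. Poly_Mapping.single m (lookup p m))"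
proof (rule poly_mapping_eqI)
  fix k
  show "lookup p k = lookup (\<Sum>m\<in>Poly_Mapping.keys p. Poly_Mapping.single m (lookup p m)) k"
    by (auto simp: lookup_sum lookup_single when_def in_keys_iff)
qed

lemma poly_induct [case_names single add]:
  assumes "\<And>m c. P (Poly_Mapping.single m c)" and "\<And>p q. P p \<Longrightarrow> P q \<Longrightarrow> P (p + q)"
  shows "P (p :: 'm \<Rightarrow>\<^sub>0 'k::comm_monoid_add)"
proof -
  have "finite A \<Longrightarrow> P (\<Sum>m\<in>A. Poly_Mapping.single m (lookup p m))" for A
  proof (induction A rule: finite_induct)
    case empty
    then show ?case using assms(1)[of undefined 0] by simp
  qed (use assms in simp)
  then show ?thesis using poly_eq_sum_single[of p] by (metis finite_keys)
qed

instance var :: (finite) finite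
proof
  have "(UNIV :: 'a var set) = range X \<union> range Y"
    by (metis UNIV_eq_I UnI1 UnI2 rangeI var.exhaust)
  then show "finite (UNIV :: 'a var set)" by (metis finite finite_Un finite_imageI)
qed

text \<open>The order on the variables only serves to order the monomials: it makes the polynomial ring an
instance of an integral domain.\<close>

instantiation var :: (linorder) linorder
begin

fun less_eq_var :: "'a var \<Rightarrow> 'a var \<Rightarrow> bool" where
  "X i \<le> X j \<longleftrightarrow> i \<le> j"
| "X i \<le> Y j \<longleftrightarrow> True"
| "Y i \<le> X j \<longleftrightarrow> False"
| "Y i \<le> Y j \<longleftrightarrow> i \<le> j"

definition less_var :: "'a var \<Rightarrow> 'a var \<Rightarrow> bool" where
  "less_var p q \<longleftrightarrow> p \<le> q \<and> \<not> q \<le> p"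

instance
proof
  fix p q r :: "'a var"
  show "p < q \<longleftrightarrow> p \<le> q \<and> \<not> q \<le> p" by (rule less_var_def)
  show "p \<le> p" by (cases p) auto
  show "p \<le> q \<Longrightarrow> q \<le> r \<Longrightarrow> p \<le> r" by (cases p; cases q; cases r) auto
  show "p \<le> q \<Longrightarrow> q \<le> p \<Longrightarrow> p = q" by (cases p; cases q) auto
  show "p \<le> q \<or> q \<le> p" by (cases p; cases q) auto
qed

end

text \<open>The $K$-linear extension of a map \<open>h\<close> on monomials. For multiplicative \<open>h\<close> it is a ring
homomorphism; substitutions, also those that set variables to zero, are of this form.\<close>

definition mon_extend ::
  "('m \<Rightarrow> 'n::comm_monoid_add \<Rightarrow>\<^sub>0 'k) \<Rightarrow> ('m \<Rightarrow>\<^sub>0 'k) \<Rightarrow> 'n \<Rightarrow>\<^sub>0 'k::comm_ring_1" where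
  "mon_extend h p = (\<Sum>m\<in>Poly_Mapping.keys p. Poly_Mapping.single 0 (lookup p m) * h m)"

lemma mon_extend_superset:
  assumes "finite A" "Poly_Mapping.keys p \<subseteq> A"
  shows "mon_extend h p = (\<Sum>m\<in>A. Poly_Mapping.single 0 (lookup p m) * h m)"
  unfolding mon_extend_def using assms by (intro sum.mono_neutral_left) (auto simp: in_keys_iff)

lemma mon_extend_zero [simp]: "mon_extend h 0 = 0"
  by (simp add: mon_extend_def)

lemma mon_extend_single [simp]:
  "mon_extend h (Poly_Mapping.single m c) = Poly_Mapping.single 0 c * h m"
  by (cases "c = 0") (simp_all add: mon_extend_def)

lemma mon_extend_add: "mon_extend h (p + q) = mon_extend h p + mon_extend h q"
proof -
  let ?A = "Poly_Mapping.keys p \<union> Poly_Mapping.keys q"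
  have "mon_extend h (p + q) = (\<Sum>m\<in>?A. Poly_Mapping.single 0 (lookup (p + q) m) * h m)"
    by (intro mon_extend_superset) (use keys_add[of p q] in auto)
  also have "\<dots> = (\<Sum>m\<in>?A. Poly_Mapping.single 0 (lookup p m) * h m) +
      (\<Sum>m\<in>?A. Poly_Mapping.single 0 (lookup q m) * h m)"
    by (simp add: lookup_add single_add algebra_simps sum.distrib)
  also have "\<dots> = mon_extend h p + mon_extend h q"
    by (simp add: mon_extend_superset[of ?A])
  finally show ?thesis .
qed

lemma mon_extend_diff: "mon_extend h (p - q) = mon_extend h p - mon_extend h q"
  by (metis mon_extend_add add_diff_cancel_right' diff_add_cancel)

lemma mon_extend_mult:
  fixes h :: "'m::comm_monoid_add \<Rightarrow> 'n::comm_monoid_add \<Rightarrow>\<^sub>0 'k::comm_ring_1"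
  assumes "\<And>m m'. h (m + m') = h m * h m'"
  shows "mon_extend h (p * q) = mon_extend h p * mon_extend h q"
proof (induction p rule: poly_induct)
  case (single m c)
  show ?case
  proof (induction q rule: poly_induct)
    case (single n d)
    have "mon_extend h (Poly_Mapping.single m c * Poly_Mapping.single n d) =
        Poly_Mapping.single (0 + 0) (c * d) * (h m * h n)"
      by (simp add: mult_single assms)
    also have "\<dots> = Poly_Mapping.single 0 c * Poly_Mapping.single 0 d * (h m * h n)"
      by (simp only: mult_single)
    also have "\<dots> = Poly_Mapping.single 0 c * h m * (Poly_Mapping.single 0 d * h n)"
      by (simp only: mult_ac)
    finally show ?case by simp
  next
    case (add q r)
    show ?case by (simp only: distrib_left mon_extend_add add)
  qed
next
  case (add p r)
  show ?case by (simp only: distrib_right mon_extend_add add)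
qed

lemma mon_extend_kernel_ideal:
  fixes h :: "'m::comm_monoid_add \<Rightarrow> 'n::comm_monoid_add \<Rightarrow>\<^sub>0 'k::comm_ring_1"
  assumes "\<And>m m'. h (m + m') = h m * h m'" and "\<And>b. b \<in> B \<Longrightarrow> mon_extend h b = 0"
    and "p \<in> Modules.module.span (*) B"
  shows "mon_extend h p = 0"
  using assms(3)
proof (induction rule: ideal_gen_induct)
  case (step c x y)
  then show ?case by (simp add: mon_extend_add mon_extend_mult[OF assms(1)] assms(2))
qed simp

section \<open>The toric map of a labelling of the vertices\<close>

text \<open>The image of a monomial under $x_i \mapsto t_i a_{c(i)}$, $y_i \mapsto t_i$. The variable
\<open>Y i\<close> is reused as $t_i$ and \<open>X k\<close> as $a_k$, so that the target is again a
polynomial ring over the same vertices.\<close>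

definition toric_exponent :: "('v::finite \<Rightarrow> 'v) \<Rightarrow> ('v var \<Rightarrow>\<^sub>0 nat) \<Rightarrow> 'v var \<Rightarrow>\<^sub>0 nat" where
  "toric_exponent c m = (\<Sum>i\<in>UNIV. Poly_Mapping.single (Y i) (lookup m (X i) + lookup m (Y i)) +
     Poly_Mapping.single (X (c i)) (lookup m (X i)))"

lemma toric_exponent_add: "toric_exponent c (m + n) = toric_exponent c m + toric_exponent c n"
  by (simp add: toric_exponent_def lookup_add single_add sum.distrib algebra_simps)

lemma lookup_toric_exponent_Y: "lookup (toric_exponent c m) (Y i) = lookup m (X i) + lookup m (Y i)"
  by (simp add: toric_exponent_def lookup_sum lookup_add lookup_single when_def sum.distrib)

lemma lookup_toric_exponent_X:
  "lookup (toric_exponent c m) (X k) = (\<Sum>i | c i = k. lookup m (X i))"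
  by (simp add: toric_exponent_def lookup_sum lookup_add lookup_single when_def sum.distrib
      sum.If_cases)

lemma toric_exponent_X:
  "toric_exponent c (Poly_Mapping.single (X i) 1) = Poly_Mapping.single (Y i) 1 + Poly_Mapping.single (X (c i)) 1"
  by (rule poly_mapping_eqI, rename_tac z, case_tac z)
    (auto simp: lookup_toric_exponent_Y lookup_toric_exponent_X lookup_add lookup_single when_def sum.delta)

lemma toric_exponent_Y:
  "toric_exponent c (Poly_Mapping.single (Y i) 1) = Poly_Mapping.single (Y i) 1"
  by (rule poly_mapping_eqI, rename_tac z, case_tac z)
    (auto simp: lookup_toric_exponent_Y lookup_toric_exponent_X lookup_add lookup_single when_def sum.delta)

definition toric_map :: "('v::finite \<Rightarrow> 'v) \<Rightarrow> ('v, 'k::field) polyring \<Rightarrow> ('v, 'k) polyring" where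
  "toric_map c = mon_extend (\<lambda>m. Poly_Mapping.single (toric_exponent c m) 1)"

lemma toric_map_mult: "toric_map c (p * q) = toric_map c p * toric_map c q"
  unfolding toric_map_def by (rule mon_extend_mult) (simp add: toric_exponent_add mult_single)

lemma edge_binomial_swap: "edge_binomial j i = - edge_binomial i j"
  by (simp add: edge_binomial_def)

lemma edge_binomial_self [simp]: "edge_binomial i i = 0"
  by (simp add: edge_binomial_def)

lemma edge_binomial_eq:
  "edge_binomial i j = Poly_Mapping.single (Poly_Mapping.single (X i) 1 + Poly_Mapping.single (Y j) 1) 1 -
     Poly_Mapping.single (Poly_Mapping.single (X j) 1 + Poly_Mapping.single (Y i) 1) 1"
  by (simp add: edge_binomial_def indet_def mult_single)

lemma toric_map_edge_binomial:
  "toric_map c (edge_binomial i j) =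
    Poly_Mapping.single (Poly_Mapping.single (X (c i)) 1 + Poly_Mapping.single (Y i) 1 + Poly_Mapping.single (Y j) 1) 1 -
    Poly_Mapping.single (Poly_Mapping.single (X (c j)) 1 + Poly_Mapping.single (Y i) 1 + Poly_Mapping.single (Y j) 1) 1"
  by (simp add: edge_binomial_eq toric_map_def mon_extend_diff toric_exponent_add
      toric_exponent_X toric_exponent_Y add_ac del: One_nat_def)

definition toric_ideal :: "('v::linorder \<Rightarrow> 'v) \<Rightarrow> ('v, 'k::field) polyring set" where
  "toric_ideal c = ideal_gen {edge_binomial i j | i j. i < j \<and> c i = c j}"

lemma edge_binomial_in_ideal_gen:
  fixes i j :: "'v::linorder"
  assumes "P i j" "P j i"
  shows "edge_binomial i j \<in> (ideal_gen {edge_binomial i j | i j. i < j \<and> P i j} :: ('v, 'k::field) polyring set)"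
proof (cases i j rule: linorder_cases)
  case greater
  then have "edge_binomial j i \<in> (ideal_gen {edge_binomial i j | i j. i < j \<and> P i j} :: ('v, 'k) polyring set)"
    using assms by (intro ideal_gen_base) auto
  from ideal_gen_neg[OF this] show ?thesis by (simp flip: edge_binomial_swap)
next
  case equal
  then show ?thesis by (simp add: ideal_gen_zero)
next
  case less
  then show ?thesis using assms by (intro ideal_gen_base) auto
qed

lemma edge_binomial_in_toric_ideal: "c i = c j \<Longrightarrow> edge_binomial i j \<in> toric_ideal c"
  unfolding toric_ideal_def by (rule edge_binomial_in_ideal_gen) auto

text \<open>Monomials with the same toric image differ by swaps $x_i y_j \leftrightarrow x_j y_i$ between
vertices of the same label, and each swap is a multiple of $f_{ij}$. The induction is on the
excess of the $x$-exponents of the first monomial over those of the second.\<close>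

lemma monom_minus_in_toric_ideal:
  fixes c :: "'v::{finite,linorder} \<Rightarrow> 'v"
  assumes "toric_exponent c m = toric_exponent c m'"
  shows "Poly_Mapping.single m 1 - Poly_Mapping.single m' 1 \<in> (toric_ideal c :: ('v, 'k::field) polyring set)"
  using assms
proof (induction "\<Sum>i\<in>UNIV. lookup m (X i) - lookup m' (X i)" arbitrary: m rule: less_induct)
  case less
  have Ysum: "lookup m (X i) + lookup m (Y i) = lookup m' (X i) + lookup m' (Y i)" for i
    using less.prems by (simp flip: lookup_toric_exponent_Y[of c])
  have Xsum: "(\<Sum>i | c i = k. lookup m (X i)) = (\<Sum>i | c i = k. lookup m' (X i))" for k
    using less.prems by (simp flip: lookup_toric_exponent_X)
  show ?case
  proof (cases "\<exists>i. lookup m' (X i) < lookup m (X i)")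
    case False
    then have le: "lookup m (X i) \<le> lookup m' (X i)" for i by (simp add: not_less)
    have X: "lookup m (X i) = lookup m' (X i)" for i
    proof (rule ccontr)
      assume "lookup m (X i) \<noteq> lookup m' (X i)"
      then have "(\<Sum>l | c l = c i. lookup m (X l)) < (\<Sum>l | c l = c i. lookup m' (X l))"
        using le by (intro sum_strict_mono_ex1) (auto simp: order_less_le)
      then show False using Xsum by simp
    qed
    have "m = m'"
    proof (rule poly_mapping_eqI)
      fix z show "lookup m z = lookup m' z"
      proof (cases z)
        case (Y i) then show ?thesis using Ysum[of i] X[of i] by simp
      qed (use X in simp)
    qed
    then show ?thesis by (simp add: toric_ideal_def ideal_gen_zero)
  next
    case True
    then obtain i where i: "lookup m' (X i) < lookup m (X i)" by blast
    \<comment> \<open>the total $x$-degree in a label class is the same for both monomials, so an excess at $i$ is compensated at some $j$\<close>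
    have "\<exists>j. c j = c i \<and> lookup m (X j) < lookup m' (X j)"
    proof (rule ccontr)
      assume *: "\<not> ?thesis"
      have "(\<Sum>l | c l = c i. lookup m' (X l)) < (\<Sum>l | c l = c i. lookup m (X l))"
        using * i by (intro sum_strict_mono_ex1) (auto simp: not_less)
      then show False using Xsum by simp
    qed
    then obtain j where j: "c j = c i" "lookup m (X j) < lookup m' (X j)" by blast
    have ij: "i \<noteq> j" using i j by auto
    have Yj: "0 < lookup m (Y j)" using Ysum[of j] j by simp
    define s where "s z = Poly_Mapping.single z (1::nat)" for z :: "'v var"
    define n where "n = m - (s (X i) + s (Y j))"
    define m2 where "m2 = n + s (X j) + s (Y i)"
    have m: "m = n + s (X i) + s (Y j)"
      by (rule poly_mapping_eqI)
        (use i Yj in \<open>auto simp: n_def s_def lookup_add lookup_minus lookup_single when_def\<close>)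
    have tor: "toric_exponent c m2 = toric_exponent c m"
      unfolding m m2_def s_def toric_exponent_add toric_exponent_X toric_exponent_Y j(1) by (simp add: add_ac)
    have m2X: "lookup m2 (X l) = (if l = i then lookup m (X i) - 1 else if l = j then lookup m (X j) + 1 else lookup m (X l))" for l
      using i ij by (auto simp: m2_def n_def s_def lookup_add lookup_minus lookup_single when_def)
    have "(\<Sum>l\<in>UNIV. lookup m2 (X l) - lookup m' (X l)) < (\<Sum>l\<in>UNIV. lookup m (X l) - lookup m' (X l))"
    proof (rule sum_strict_mono_ex1)
      show "\<forall>l\<in>UNIV. lookup m2 (X l) - lookup m' (X l) \<le> lookup m (X l) - lookup m' (X l)"
        using j(2) by (auto simp: m2X)
      show "\<exists>l\<in>UNIV. lookup m2 (X l) - lookup m' (X l) < lookup m (X l) - lookup m' (X l)"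
        by (rule bexI[of _ i]) (use i in \<open>simp_all add: m2X\<close>)
    qed simp
    from less.hyps[OF this] have IH: "Poly_Mapping.single m2 1 - Poly_Mapping.single m' 1 \<in> (toric_ideal c :: ('v, 'k) polyring set)"
      using tor less.prems by simp
    have "Poly_Mapping.single n 1 * edge_binomial i j \<in> (toric_ideal c :: ('v, 'k) polyring set)"
      unfolding toric_ideal_def
      by (rule ideal_gen_mult_left, fold toric_ideal_def) (simp add: edge_binomial_in_toric_ideal j(1))
    also have "Poly_Mapping.single n 1 * edge_binomial i j = Poly_Mapping.single m 1 - (Poly_Mapping.single m2 1 :: ('v, 'k) polyring)"
      by (simp add: edge_binomial_eq right_diff_distrib mult_single m m2_def s_def add_ac)
    finally have "Poly_Mapping.single m 1 - Poly_Mapping.single m2 1 \<in> (toric_ideal c :: ('v, 'k) polyring set)" .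
    from ideal_gen_add[OF this[unfolded toric_ideal_def] IH[unfolded toric_ideal_def]]
    show ?thesis unfolding toric_ideal_def by simp
  qed
qed

text \<open>A linear section \<open>L\<close> of the toric map on its image sends a monomial to a chosen preimage. By
the preceding lemma $p - L(\mathrm{toric}(p))$ always lies in the ideal, so $p$ does as soon as
its toric image vanishes.\<close>

lemma toric_ideal_eq_kernel:
  fixes c :: "'v::{finite,linorder} \<Rightarrow> 'v"
  shows "(toric_ideal c :: ('v, 'k::field) polyring set) = {p. toric_map c p = 0}"
proof (intro subset_antisym subsetI)
  fix p :: "('v, 'k) polyring"
  assume "p \<in> toric_ideal c"
  then have p: "p \<in> ideal_gen {edge_binomial i j | i j. i < j \<and> c i = c j}"
    by (simp only: toric_ideal_def)
  have "mon_extend (\<lambda>m. Poly_Mapping.single (toric_exponent c m) 1) p = 0"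
  proof (rule mon_extend_kernel_ideal[OF _ _ p])
    fix b :: "('v, 'k) polyring"
    assume "b \<in> {edge_binomial i j | i j. i < j \<and> c i = c j}"
    then obtain i j where "b = edge_binomial i j" "c i = c j" by blast
    then show "mon_extend (\<lambda>m. Poly_Mapping.single (toric_exponent c m) 1) b = 0"
      unfolding toric_map_def[symmetric] by (simp add: toric_map_edge_binomial)
  qed (simp add: toric_exponent_add mult_single)
  then show "p \<in> {p. toric_map c p = 0}" by (simp add: toric_map_def)
next
  fix p :: "('v, 'k) polyring"
  assume "p \<in> {p. toric_map c p = 0}"
  define r where "r k = (SOME m. toric_exponent c m = k)" for k
  have r: "toric_exponent c (r (toric_exponent c m)) = toric_exponent c m" for m
    unfolding r_def by (rule someI) simp
  define L :: "('v, 'k) polyring \<Rightarrow> ('v, 'k) polyring" where "L = mon_extend (\<lambda>k. Poly_Mapping.single (r k) 1)"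
  have "p - L (toric_map c p) \<in> toric_ideal c" for p :: "('v, 'k) polyring"
  proof (induction p rule: poly_induct)
    case (single m a)
    have "Poly_Mapping.single 0 a * (Poly_Mapping.single m 1 - Poly_Mapping.single (r (toric_exponent c m)) 1) \<in> toric_ideal c"
      unfolding toric_ideal_def
      by (rule ideal_gen_mult_left, fold toric_ideal_def) (rule monom_minus_in_toric_ideal, simp add: r)
    then show ?case by (simp add: right_diff_distrib mult_single L_def toric_map_def)
  next
    case (add p q)
    have eq: "p + q - L (toric_map c (p + q)) = p - L (toric_map c p) + (q - L (toric_map c q))"
      by (simp add: L_def toric_map_def mon_extend_add)
    show ?case
      unfolding eq toric_ideal_def
      by (rule ideal_gen_add) (rule add[unfolded toric_ideal_def])+
  qed
  from this[of p] show "p \<in> toric_ideal c" using \<open>p \<in> _\<close> by (simp add: L_def)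
qed

section \<open>The grading\<close>

lemma monom_degree_eq: "monom_degree m = (\<Sum>z\<in>UNIV. lookup m z)" for m :: "'v::finite var \<Rightarrow>\<^sub>0 nat"
  unfolding monom_degree_def by (rule sum.mono_neutral_left) (auto simp: in_keys_iff)

lemma monom_degree_add: "monom_degree (m + n) = monom_degree m + monom_degree n"
  for m :: "'v::finite var \<Rightarrow>\<^sub>0 nat"
  by (simp add: monom_degree_eq lookup_add sum.distrib)

lemma graded_part_zero [simp]: "0 \<in> graded_part d"
  by (simp add: graded_part_def)

lemma graded_part_add: "p \<in> graded_part d \<Longrightarrow> q \<in> graded_part d \<Longrightarrow> p + q \<in> graded_part d"
  using keys_add[of p q] by (auto simp: graded_part_def)

lemma graded_part_uminus: "p \<in> graded_part d \<Longrightarrow> - p \<in> graded_part d"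
  by (simp add: graded_part_def in_keys_iff)

lemma graded_part_diff: "p \<in> graded_part d \<Longrightarrow> q \<in> graded_part d \<Longrightarrow> p - q \<in> graded_part d"
  using graded_part_add[of p d "- q"] graded_part_uminus[of q d] by simp

lemma graded_part_single: "int (monom_degree m) = d \<Longrightarrow> Poly_Mapping.single m c \<in> graded_part d"
  by (simp add: graded_part_def)

lemma graded_part_mult:
  fixes p q :: "('v::finite, 'k::field) polyring"
  assumes "p \<in> graded_part d" "q \<in> graded_part e"
  shows "p * q \<in> graded_part (d + e)"
  unfolding graded_part_def
proof (intro CollectI ballI)
  fix m assume "m \<in> Poly_Mapping.keys (p * q)"
  then obtain a b where "m = a + b" "a \<in> Poly_Mapping.keys p" "b \<in> Poly_Mapping.keys q"
    using keys_mult by blast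
  then show "int (monom_degree m) = d + e"
    using assms by (auto simp: graded_part_def monom_degree_add)
qed

lemma monom_degree_single [simp]: "monom_degree (Poly_Mapping.single z k) = k"
  by (simp add: monom_degree_def)

lemma indet_graded: "indet z \<in> graded_part 1"
  by (simp add: indet_def graded_part_single)

lemma prod_indet_graded:
  fixes g :: "'b \<Rightarrow> 'v::finite var"
  assumes "finite A"
  shows "(\<Prod>i\<in>A. indet (g i) :: ('v, 'k::field) polyring) \<in> graded_part (int (card A))"
  using assms
proof (induction A rule: finite_induct)
  case empty
  show ?case
    using graded_part_single[of 0 0] by (simp add: monom_degree_def flip: single_one)
next
  case (insert x F)
  then show ?case using graded_part_mult[OF indet_graded[of "g x"] insert.IH] by (simp add: add_ac)
qed

lemma lookup_single_mult_add:
  fixes p :: "('m::cancel_comm_monoid_add) \<Rightarrow>\<^sub>0 'k::comm_ring_1"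
  shows "lookup (Poly_Mapping.single s c * p) (s + m) = c * lookup p m"
proof (induction p rule: poly_induct)
  case (single n d)
  show ?case by (simp add: mult_single lookup_single when_def)
next
  case (add p q)
  then show ?case by (simp add: distrib_left lookup_add)
qed

section \<open>Connected components\<close>

lemma same_component_refl: "same_component H i i"
  by (simp add: same_component_def)

lemma same_component_trans: "same_component H i j \<Longrightarrow> same_component H j k \<Longrightarrow> same_component H i k"
  unfolding same_component_def by (rule rtrancl_trans)

lemma same_component_sym: "same_component H i j \<Longrightarrow> same_component H j i"
proof -
  have "sym {(a, b). {a, b} \<in> H}" by (auto simp: sym_def insert_commute)
  then have "sym ({(a, b). {a, b} \<in> H}\<^sup>*)" by (rule sym_rtrancl)
  then show "same_component H i j \<Longrightarrow> same_component H j i"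
    by (auto simp: same_component_def dest: symD)
qed

lemma same_component_edge: "{i, j} \<in> H \<Longrightarrow> same_component H i j"
  by (auto simp: same_component_def)

text \<open>The least vertex of a component labels the component. In a whisker graph this is never a leaf.\<close>

definition comp_rep :: "'v::{finite,linorder} set set \<Rightarrow> 'v \<Rightarrow> 'v" where
  "comp_rep H i = Min {j. same_component H i j}"

lemma same_component_comp_rep: "same_component H i (comp_rep H i)"
proof -
  have "comp_rep H i \<in> {j. same_component H i j}"
    unfolding comp_rep_def by (rule Min_in) (auto intro: same_component_refl)
  then show ?thesis by simp
qed

lemma comp_rep_le: "same_component H i j \<Longrightarrow> comp_rep H i \<le> j"
  unfolding comp_rep_def by (rule Min_le) auto

lemma comp_rep_eq_iff: "comp_rep H i = comp_rep H j \<longleftrightarrow> same_component H i j"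
proof
  show "comp_rep H i = comp_rep H j \<Longrightarrow> same_component H i j"
    by (metis same_component_comp_rep same_component_sym same_component_trans)
  assume "same_component H i j"
  then have "{k. same_component H i k} = {k. same_component H j k}"
    by (blast intro: same_component_trans same_component_sym)
  then show "comp_rep H i = comp_rep H j" by (simp add: comp_rep_def)
qed

lemma P_empty_eq_toric_ideal: "P_empty H = toric_ideal (comp_rep H)"
  by (simp add: P_empty_def toric_ideal_def comp_rep_eq_iff)

lemma edge_binomial_in_binomial_edge_ideal:
  "{i, j} \<in> H \<Longrightarrow> edge_binomial i j \<in> binomial_edge_ideal H"
  using edge_binomial_in_ideal_gen[of "\<lambda>i j. {i, j} \<in> H" i j]
  unfolding binomial_edge_ideal_def by (simp add: insert_commute conj_commute)

lemma binomial_edge_ideal_mult_left: "p \<in> binomial_edge_ideal H \<Longrightarrow> q * p \<in> binomial_edge_ideal H"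
  unfolding binomial_edge_ideal_def by (rule ideal_gen_mult_left)

lemma binomial_edge_ideal_add:
  "p \<in> binomial_edge_ideal H \<Longrightarrow> q \<in> binomial_edge_ideal H \<Longrightarrow> p + q \<in> binomial_edge_ideal H"
  unfolding binomial_edge_ideal_def by (rule ideal_gen_add)

lemma binomial_edge_ideal_subset_P_empty: "binomial_edge_ideal H \<subseteq> P_empty H"
  unfolding binomial_edge_ideal_def P_empty_def
  by (rule ideal_gen_mono) (auto intro: same_component_edge)

section \<open>Binomials of paths\<close>

text \<open>The reflexive transitive closure describes walks in which every vertex except possibly the last
one lies in \<open>A\<close>.\<close>

definition steps_from :: "'v set set \<Rightarrow> 'v set \<Rightarrow> ('v \<times> 'v) set" where
  "steps_from H A = {(a, b). a \<in> A \<and> {a, b} \<in> H}"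

lemma steps_from_iff: "(a, b) \<in> steps_from H A \<longleftrightarrow> a \<in> A \<and> {a, b} \<in> H"
  by (simp add: steps_from_def)

text \<open>After its last visit to the start vertex, a walk continues without it. This turns walks into
paths, so that each inner vertex contributes its variable only once.\<close>

lemma last_exit:
  assumes "(w, q) \<in> (steps_from H A)\<^sup>*"
  shows "w = q \<or> (\<exists>w'. {w, w'} \<in> H \<and> (w', q) \<in> (steps_from H (A - {w}))\<^sup>*)"
  using assms
proof (induction rule: rtrancl_induct)
  case (step q r)
  show ?case
  proof (cases "q = w")
    case True
    then have "{w, r} \<in> H" using step.hyps(2) by (simp add: steps_from_iff)
    then show ?thesis by blast
  next
    case False
    then obtain w' where w': "{w, w'} \<in> H" "(w', q) \<in> (steps_from H (A - {w}))\<^sup>*"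
      using step.IH by blast
    have "(q, r) \<in> steps_from H (A - {w})" using step.hyps False by (simp add: steps_from_iff)
    then show ?thesis using w' by (meson rtrancl.rtrancl_into_rtrancl)
  qed
qed simp

lemma edge_binomial_via:
  "indet (X w) * edge_binomial p q = indet (X p) * edge_binomial w q + indet (X q) * edge_binomial p w"
  by (simp add: edge_binomial_def algebra_simps)

text \<open>Induction along the path by \<open>edge_binomial_via\<close>: passing through a vertex costs one
factor $x_w$, and by \<open>last_exit\<close> the rest of the path avoids $w$.\<close>

lemma path_edge_binomial:
  assumes "finite A" "{p, w} \<in> H" "(w, q) \<in> (steps_from H A)\<^sup>*"
  shows "(\<Prod>v\<in>A. indet (X v)) * edge_binomial p q \<in> (binomial_edge_ideal H :: ('v::linorder, 'k::field) polyring set)"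
  using assms
proof (induction "card A" arbitrary: A p w rule: less_induct)
  case less
  let ?J = "binomial_edge_ideal H :: ('v, 'k) polyring set"
  have pw: "edge_binomial p w \<in> ?J" using less.prems by (simp add: edge_binomial_in_binomial_edge_ideal)
  show ?case
  proof (cases "w = q")
    case True
    then show ?thesis using binomial_edge_ideal_mult_left[OF pw] by simp
  next
    case False
    have wA: "w \<in> A" using less.prems(3) False by (cases rule: converse_rtranclE) (auto simp: steps_from_iff)
    obtain w' where w': "{w, w'} \<in> H" "(w', q) \<in> (steps_from H (A - {w}))\<^sup>*"
      using last_exit[OF less.prems(3)] False by blast
    define a where "a = (\<Prod>v\<in>A - {w}. indet (X v) :: ('v, 'k) polyring)"
    have "card (A - {w}) < card A" using wA less.prems(1) by (rule card_Diff1_less[rotated])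
    then have IH: "a * edge_binomial w q \<in> ?J"
      unfolding a_def by (rule less.hyps) (use less.prems(1) w' in auto)
    have "(\<Prod>v\<in>A. indet (X v)) * edge_binomial p q = a * (indet (X w) * edge_binomial p q)"
      unfolding a_def prod.remove[OF less.prems(1) wA] by (simp add: mult_ac)
    also have "\<dots> = indet (X p) * (a * edge_binomial w q) + (a * indet (X q)) * edge_binomial p w"
      by (subst edge_binomial_via) (simp add: algebra_simps)
    also have "\<dots> \<in> ?J" 
      by (rule binomial_edge_ideal_add[OF binomial_edge_ideal_mult_left[OF IH] binomial_edge_ideal_mult_left[OF pw]])
    finally show ?thesis .
  qed
qed

section \<open>The colon ideal of the product of the inner variables\<close>

lemma whisker_edge_Leaf: "{Leaf i, q} \<in> whisker_graph E \<longleftrightarrow> q = Orig i"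
  by (auto simp: whisker_graph_def doubleton_eq_iff)

lemma whisker_edge_Leaf': "{q, Leaf i} \<in> whisker_graph E \<longleftrightarrow> q = Orig i"
  by (subst insert_commute) (rule whisker_edge_Leaf)

lemma whisker_edge_Orig: "{Orig i, Orig j} \<in> whisker_graph E \<longleftrightarrow> {i, j} \<in> E"
proof
  assume "{Orig i, Orig j} \<in> whisker_graph E"
  then obtain e where "e \<in> E" "{Orig i, Orig j} = Orig ` e"
    by (auto simp: whisker_graph_def doubleton_eq_iff)
  moreover have "{Orig i, Orig j} = Orig ` {i, j}" by simp
  ultimately have "e = {i, j}" by (metis inj_image_eq_iff injI whisker_vertex.inject(1))
  then show "{i, j} \<in> E" using \<open>e \<in> E\<close> by simp
next
  assume "{i, j} \<in> E"
  then have "Orig ` {i, j} \<in> whisker_graph E" unfolding whisker_graph_def by blast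
  then show "{Orig i, Orig j} \<in> whisker_graph E" by simp
qed

text \<open>A leaf has a single neighbour, so a walk that passes through a leaf can be shortened. Hence all
inner vertices may be taken among the $v_i$.\<close>

lemma whisker_path:
  assumes "same_component (whisker_graph E) p q"
  shows "p = q \<or> (\<exists>w. {p, w} \<in> whisker_graph E \<and> (w, q) \<in> (steps_from (whisker_graph E) (range Orig))\<^sup>*)"
  using assms unfolding same_component_def
proof (induction rule: rtrancl_induct)
  case (step q r)
  let ?H = "whisker_graph E"
  have qr: "{q, r} \<in> ?H" using step.hyps by simp
  show ?case
  proof (cases "q = p")
    case True
    then show ?thesis using qr by blast
  next
    case False
    then obtain w where w: "{p, w} \<in> ?H" "(w, q) \<in> (steps_from ?H (range Orig))\<^sup>*"
      using step.IH by blast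
    show ?thesis
    proof (cases q)
      case (Orig i)
      then have "(q, r) \<in> steps_from ?H (range Orig)" using qr by (simp add: steps_from_iff)
      then show ?thesis using w by (meson rtrancl.rtrancl_into_rtrancl)
    next
      case (Leaf i)
      then have r: "r = Orig i" using qr by (simp add: whisker_edge_Leaf)
      show ?thesis
      proof (cases "w = q")
        case True
        then show ?thesis using w(1) Leaf r by (simp add: whisker_edge_Leaf')
      next
        case False
        obtain s where s: "(w, s) \<in> (steps_from ?H (range Orig))\<^sup>*" "{s, q} \<in> ?H"
          using w(2) False by (cases rule: rtranclE) (auto simp: steps_from_iff)
        then have "s = r" using Leaf r by (simp add: whisker_edge_Leaf')
        then show ?thesis using s(1) w(1) by blast
      qed
    qed
  qed
qed simp

lemma single_eq_0_iff: "Poly_Mapping.single m c = 0 \<longleftrightarrow> c = 0"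
  by (metis lookup_single_eq lookup_zero single_zero)

lemma toric_map_indet_nonzero: "toric_map c (indet z :: ('v::finite, 'k::field) polyring) \<noteq> 0"
  by (simp add: toric_map_def indet_def mult_single single_eq_0_iff)

lemma toric_map_one: "toric_map c 1 = 1"
proof -
  have "toric_map c (Poly_Mapping.single 0 1) = Poly_Mapping.single 0 1"
    by (simp add: toric_map_def mult_single toric_exponent_def del: single_one)
  then show ?thesis by simp
qed

lemma toric_map_prod_nonzero:
  fixes g :: "'b \<Rightarrow> 'v::{finite,linorder} var"
  shows "toric_map c (\<Prod>i\<in>A. indet (g i) :: ('v, 'k::field) polyring) \<noteq> 0"
  by (induction A rule: infinite_finite_induct)
    (simp_all add: toric_map_mult toric_map_indet_nonzero toric_map_one)

lemma colon_prod_Orig: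
  fixes E :: "'a::{finite,linorder} set set"
  shows "colon (binomial_edge_ideal (whisker_graph E))
     (\<Prod>i\<in>UNIV. indet (X (Orig i)) :: ('a whisker_vertex, 'k::field) polyring) = P_empty (whisker_graph E)"
proof (intro subset_antisym subsetI)
  let ?H = "whisker_graph E"
  define f where "f = (\<Prod>i\<in>UNIV. indet (X (Orig i)) :: ('a whisker_vertex, 'k) polyring)"
  have toric_f: "toric_map (comp_rep ?H) f \<noteq> 0" unfolding f_def by (rule toric_map_prod_nonzero)
  fix g :: "('a whisker_vertex, 'k) polyring"
  assume "g \<in> colon (binomial_edge_ideal ?H) (\<Prod>i\<in>UNIV. indet (X (Orig i)))"
  then have "g * f \<in> binomial_edge_ideal ?H" by (simp only: colon_def f_def mem_Collect_eq)
  then have "g * f \<in> P_empty ?H" by (rule subsetD[OF binomial_edge_ideal_subset_P_empty])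
  then have "toric_map (comp_rep ?H) g * toric_map (comp_rep ?H) f = 0"
    by (simp only: P_empty_eq_toric_ideal toric_ideal_eq_kernel mem_Collect_eq toric_map_mult)
  then have "toric_map (comp_rep ?H) g = 0" using toric_f by simp
  then show "g \<in> P_empty ?H" by (simp only: P_empty_eq_toric_ideal toric_ideal_eq_kernel mem_Collect_eq)
next
  let ?H = "whisker_graph E"
  let ?J = "binomial_edge_ideal ?H :: ('a whisker_vertex, 'k) polyring set"
  define f where "f = (\<Prod>i\<in>UNIV. indet (X (Orig i)) :: ('a whisker_vertex, 'k) polyring)"
  have f: "f = (\<Prod>v\<in>range Orig. indet (X v))"
    unfolding f_def by (subst prod.reindex) (auto simp: inj_on_def)
  fix g :: "('a whisker_vertex, 'k) polyring"
  assume "g \<in> P_empty ?H"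
  then have "g * f \<in> ?J"
    unfolding P_empty_def
  proof (induction rule: ideal_gen_induct)
    case base
    show ?case by (simp add: binomial_edge_ideal_def ideal_gen_zero)
  next
    case (step c x y)
    from step.hyps obtain p q where "x = edge_binomial p q \<and> p < q \<and> same_component ?H p q"
      unfolding mem_Collect_eq by (elim exE)
    then have x: "x = edge_binomial p q" and pq: "same_component ?H p q" "p < q" by simp_all
    obtain w where "{p, w} \<in> ?H" "(w, q) \<in> (steps_from ?H (range Orig))\<^sup>*"
      using whisker_path[OF pq(1)] less_imp_neq[OF pq(2)] by (elim disjE exE conjE) simp_all
    then have "f * x \<in> ?J" unfolding x f by (rule path_edge_binomial[OF finite])
    then have "c * (f * x) + y * f \<in> ?J"
      by (rule binomial_edge_ideal_add[OF binomial_edge_ideal_mult_left step.IH])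
    moreover have "(c * x + y) * f = c * (f * x) + y * f" by (simp add: algebra_simps)
    ultimately show ?case by simp
  qed
  then show "g \<in> colon ?J (\<Prod>i\<in>UNIV. indet (X (Orig i)))" by (simp add: colon_def f_def)
qed

section \<open>The lower bound for the v-number\<close>

text \<open>The toric map after setting both variables at the vertex \<open>v\<close> to zero.\<close>

definition toric_map_off :: "'v \<Rightarrow> ('v::finite \<Rightarrow> 'v) \<Rightarrow> ('v, 'k::field) polyring \<Rightarrow> ('v, 'k) polyring" where
  "toric_map_off v c = mon_extend (\<lambda>m. if lookup m (X v) + lookup m (Y v) = 0
     then Poly_Mapping.single (toric_exponent c m) 1 else 0)"

lemma toric_map_off_multiplicative:
  "(if lookup (m + n) (X v) + lookup (m + n) (Y v) = 0 then Poly_Mapping.single (toric_exponent c (m + n)) 1 else 0) =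
   (if lookup m (X v) + lookup m (Y v) = 0 then Poly_Mapping.single (toric_exponent c m) (1::'k::field) else 0) *
   (if lookup n (X v) + lookup n (Y v) = 0 then Poly_Mapping.single (toric_exponent c n) 1 else 0)"
  by (simp add: lookup_add toric_exponent_add mult_single)

lemma toric_map_off_mult: "toric_map_off v c (p * q) = toric_map_off v c p * toric_map_off v c q"
  unfolding toric_map_off_def by (rule mon_extend_mult) (rule toric_map_off_multiplicative)

lemma toric_map_off_edge_binomial:
  assumes "i \<noteq> v" "j \<noteq> v"
  shows "toric_map_off v c (edge_binomial i j) = toric_map c (edge_binomial i j)"
  using assms
  by (simp add: edge_binomial_eq toric_map_off_def toric_map_def mon_extend_diff lookup_add lookup_single)

lemma toric_map_off_edge_binomial_at:
  assumes "i = v \<or> j = v"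
  shows "toric_map_off v c (edge_binomial i j) = 0"
  using assms
  by (auto simp: edge_binomial_eq toric_map_off_def mon_extend_diff lookup_add lookup_single)

lemma toric_map_edge_binomial_nonzero:
  fixes c :: "'v::finite \<Rightarrow> 'v"
  assumes "c i \<noteq> c j"
  shows "toric_map c (edge_binomial i j) \<noteq> (0 :: ('v, 'k::field) polyring)"
proof
  let ?s = "\<lambda>k. Poly_Mapping.single (X k) (1::nat) + Poly_Mapping.single (Y i) 1 + Poly_Mapping.single (Y j) 1"
  assume "toric_map c (edge_binomial i j) = (0 :: ('v, 'k) polyring)"
  from arg_cong[OF this, of "\<lambda>p. lookup p (?s (c i))"]
  have "lookup (Poly_Mapping.single (?s (c i)) 1 - Poly_Mapping.single (?s (c j)) (1::'k)) (?s (c i)) = 0"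
    unfolding toric_map_edge_binomial by (simp only: lookup_zero)
  moreover have "?s (c i) \<noteq> ?s (c j)"
  proof
    assume "?s (c i) = ?s (c j)"
    then have "lookup (?s (c i)) (X (c i)) = lookup (?s (c j)) (X (c i))" by simp
    then show False using assms by (simp add: lookup_add lookup_single)
  qed
  ultimately show False unfolding lookup_minus lookup_single by simp
qed

text \<open>A finer labelling retains more information: its $x$-degrees sum up to those of the coarser one.\<close>

lemma toric_exponent_refine:
  assumes "\<And>i j. c' i = c' j \<Longrightarrow> c i = c j" and "toric_exponent c' m = toric_exponent c' n"
  shows "toric_exponent c m = toric_exponent c n"
proof (rule poly_mapping_eqI)
  fix z show "lookup (toric_exponent c m) z = lookup (toric_exponent c n) z"
  proof (cases z)
    case (Y i)
    then show ?thesis using assms(2) by (simp flip: lookup_toric_exponent_Y[of c'] add: lookup_toric_exponent_Y[of c])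
  next
    case (X k)
    have fine: "(\<Sum>i | c i = k. lookup m (X i)) =
      (\<Sum>k' \<in> c' ` {i. c i = k}. lookup (toric_exponent c' m) (X k'))" for m
    proof -
      have "(\<Sum>i | c i = k. lookup m (X i)) =
        (\<Sum>k' \<in> c' ` {i. c i = k}. \<Sum>i \<in> {i \<in> {i. c i = k}. c' i = k'}. lookup m (X i))"
        by (rule sum.image_gen) simp
      also have "\<dots> = (\<Sum>k' \<in> c' ` {i. c i = k}. \<Sum>i | c' i = k'. lookup m (X i))"
        by (intro sum.cong) (auto dest: assms(1))
      finally show ?thesis by (simp add: lookup_toric_exponent_X)
    qed
    show ?thesis using assms(2) by (simp add: X lookup_toric_exponent_X fine)
  qed
qed

text \<open>The part of the toric image without $t_v$ only sees the monomials without $x_v$ and $y_v$, and it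
is determined by their toric images for any finer labelling.\<close>

lemma lookup_toric_map_off_zero:
  fixes c c' :: "'v::finite \<Rightarrow> 'v" and p :: "('v, 'k::field) polyring"
  assumes "\<And>i j. c' i = c' j \<Longrightarrow> c i = c j" and "toric_map_off v c' p = 0" and "lookup k (Y v) = 0"
  shows "lookup (toric_map c p) k = 0"
proof -
  define r where "r k = (SOME m. toric_exponent c' m = k)" for k
  have r': "toric_exponent c' (r (toric_exponent c' m)) = toric_exponent c' m" for m
    unfolding r_def by (rule someI) simp
  have r: "toric_exponent c (r (toric_exponent c' m)) = toric_exponent c m" for m
    by (rule toric_exponent_refine[OF assms(1) r'])
  define L :: "('v, 'k) polyring \<Rightarrow> ('v, 'k) polyring" where
    "L = mon_extend (\<lambda>k. Poly_Mapping.single (toric_exponent c (r k)) 1)"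
  have "lookup (toric_map c p) k = lookup (L (toric_map_off v c' p)) k" for p :: "('v, 'k) polyring"
  proof (induction p rule: poly_induct)
    case (single m a)
    have "lookup (toric_exponent c m) (Y v) = 0 \<longleftrightarrow> lookup m (X v) + lookup m (Y v) = 0"
      by (simp add: lookup_toric_exponent_Y)
    then show ?case
      using assms(3)
      by (auto simp: toric_map_def toric_map_off_def L_def mult_single r lookup_single when_def)
  next
    case (add p q)
    then show ?case by (simp add: toric_map_def toric_map_off_def L_def mon_extend_add lookup_add)
  qed
  then show ?thesis using assms(2) by (simp add: L_def)
qed

lemma keys_toric_map:
  assumes "k \<in> Poly_Mapping.keys (toric_map c p)"
  obtains m where "m \<in> Poly_Mapping.keys p" "k = toric_exponent c m"
proof -
  have "Poly_Mapping.keys (toric_map c p) \<subseteq>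
    (\<Union>m\<in>Poly_Mapping.keys p. Poly_Mapping.keys (Poly_Mapping.single 0 (lookup p m) * Poly_Mapping.single (toric_exponent c m) 1))"
    unfolding toric_map_def mon_extend_def by (rule keys_sum)
  also have "\<dots> \<subseteq> toric_exponent c ` Poly_Mapping.keys p"
    by (auto simp: mult_single split: if_splits)
  finally show ?thesis using assms that by blast
qed

text \<open>The toric image of $f$ is nonzero and divisible by $t_{v_i}$ for each of the $n$ vertices $v_i$.\<close>

lemma degree_ge_of_colon_eq_P_empty:
  fixes E :: "'a::{finite,linorder} set set" and f :: "('a whisker_vertex, 'k::field) polyring"
  assumes "simple_graph E" and noniso: "\<And>i. \<not> isolated_vertex E i"
    and f: "f \<in> graded_part (int d)"
    and colon: "colon (binomial_edge_ideal (whisker_graph E)) f = P_empty (whisker_graph E)"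
  shows "CARD('a) \<le> d"
proof -
  let ?H = "whisker_graph E"
  let ?c = "comp_rep ?H"
  \<comment> \<open>if $f \in P = (J : \prod_i x_{v_i})$, then $\prod_i x_{v_i} \in (J : f) = P$, which is false\<close>
  have nz: "toric_map ?c f \<noteq> 0"
  proof
    assume "toric_map ?c f = 0"
    then have "f \<in> P_empty ?H" by (simp add: P_empty_eq_toric_ideal toric_ideal_eq_kernel)
    then have "f \<in> colon (binomial_edge_ideal ?H) (\<Prod>i\<in>UNIV. indet (X (Orig i)))"
      by (simp only: colon_prod_Orig)
    then have "(\<Prod>i\<in>UNIV. indet (X (Orig i))) \<in> colon (binomial_edge_ideal ?H) f"
      by (simp add: colon_def mult.commute)
    then have "(\<Prod>i\<in>UNIV. indet (X (Orig i))) \<in> (P_empty ?H :: ('a whisker_vertex, 'k) polyring set)"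
      by (simp only: colon)
    then show False
      using toric_map_prod_nonzero[of ?c "\<lambda>i. X (Orig i)" UNIV, where 'k = 'k]
      by (simp add: P_empty_eq_toric_ideal toric_ideal_eq_kernel)
  qed
  have divisible: "lookup (toric_map ?c f) k = 0" if k: "lookup k (Y (Orig i)) = 0" for i k
  proof -
    obtain e where e: "e \<in> E" "i \<in> e" using noniso[of i] by (auto simp: isolated_vertex_def)
    then have "card e = 2" using assms(1) by (simp add: simple_graph_def)
    then obtain j where j: "e = {i, j}" "i \<noteq> j" using e(2) by (auto simp: card_2_iff)
    \<comment> \<open>the labelling in which $u_i$ is cut off from its component; no component has the representative $u_i$\<close>
    define c' where "c' q = (if q = Leaf i then Leaf i else ?c q)" for q
    have comp: "same_component ?H (Orig j) (Leaf i)"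
    proof (rule same_component_trans)
      show "same_component ?H (Orig j) (Orig i)"
        using e(1) j(1) by (intro same_component_edge) (simp add: whisker_edge_Orig insert_commute)
      show "same_component ?H (Orig i) (Leaf i)"
        by (intro same_component_edge) (simp add: whisker_edge_Leaf')
    qed
    have c_less: "?c q \<noteq> Leaf i" for q
    proof
      assume q: "?c q = Leaf i"
      have "same_component ?H q (Orig i)"
        using same_component_comp_rep[of ?H q] unfolding q
        by (rule same_component_trans) (intro same_component_edge, simp add: whisker_edge_Leaf)
      from comp_rep_le[OF this] show False by (simp add: q)
    qed
    have "toric_map_off (Orig i) c' p = 0" if "p \<in> binomial_edge_ideal ?H" for p :: "('a whisker_vertex, 'k) polyring"
      unfolding toric_map_off_def
    proof (rule mon_extend_kernel_ideal[OF toric_map_off_multiplicative _ that[unfolded binomial_edge_ideal_def]],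
        fold toric_map_off_def)
      fix b :: "('a whisker_vertex, 'k) polyring"
      assume "b \<in> {edge_binomial p q | p q. {p, q} \<in> ?H \<and> p < q}"
      then obtain p q where b: "b = edge_binomial p q" and pq: "{p, q} \<in> ?H" by blast
      show "toric_map_off (Orig i) c' b = 0"
      proof (cases "p = Orig i \<or> q = Orig i")
        case True
        then show ?thesis unfolding b by (rule toric_map_off_edge_binomial_at)
      next
        case False
        then have "p \<noteq> Leaf i" "q \<noteq> Leaf i" using pq by (auto simp: whisker_edge_Leaf whisker_edge_Leaf')
        then have "c' p = c' q" using pq by (simp add: c'_def comp_rep_eq_iff same_component_edge)
        then show ?thesis using False unfolding b by (simp add: toric_map_off_edge_binomial toric_map_edge_binomial)
      qed
    qed
    moreover have "edge_binomial (Orig j) (Leaf i) * f \<in> binomial_edge_ideal ?H"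
    proof -
      have "edge_binomial (Orig j) (Leaf i) \<in> (P_empty ?H :: ('a whisker_vertex, 'k) polyring set)"
        unfolding P_empty_eq_toric_ideal
        by (rule edge_binomial_in_toric_ideal) (simp add: comp_rep_eq_iff comp)
      then show ?thesis unfolding colon[symmetric] by (simp add: colon_def)
    qed
    ultimately have "toric_map_off (Orig i) c' (edge_binomial (Orig j) (Leaf i)) * toric_map_off (Orig i) c' f = 0"
      by (simp flip: toric_map_off_mult)
    moreover have "toric_map_off (Orig i) c' (edge_binomial (Orig j) (Leaf i)) \<noteq> (0 :: ('a whisker_vertex, 'k) polyring)"
      using j(2) c_less by (subst toric_map_off_edge_binomial) (auto intro!: toric_map_edge_binomial_nonzero simp: c'_def)
    ultimately have off: "toric_map_off (Orig i) c' f = 0" by simp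
    have refine: "?c p = ?c q" if "c' p = c' q" for p q
      using that c_less by (auto simp: c'_def split: if_splits)
    show ?thesis by (rule lookup_toric_map_off_zero[OF refine off k])
  qed
  obtain k where k: "k \<in> Poly_Mapping.keys (toric_map ?c f)"
    using nz by (auto simp flip: keys_eq_empty)
  then obtain m where m: "m \<in> Poly_Mapping.keys f" "k = toric_exponent ?c m" by (rule keys_toric_map)
  have "lookup k (Y (Orig i)) \<noteq> 0" for i using divisible[of k i] k by (auto simp: in_keys_iff)
  then have pos: "1 \<le> lookup m (X (Orig i)) + lookup m (Y (Orig i))" for i
    unfolding m(2) lookup_toric_exponent_Y by (simp add: Suc_le_eq)
  have "CARD('a) = (\<Sum>i\<in>(UNIV :: 'a set). 1)" by simp
  also have "\<dots> \<le> (\<Sum>i\<in>UNIV. lookup m (X (Orig i)) + lookup m (Y (Orig i)))"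
    by (rule sum_mono) (rule pos)
  also have "\<dots> = (\<Sum>z \<in> range (\<lambda>i. X (Orig i)) \<union> range (\<lambda>i. Y (Orig i)). lookup m z)"
    by (subst sum.union_disjoint) (auto simp: sum.reindex inj_on_def sum.distrib)
  also have "\<dots> \<le> monom_degree m" unfolding monom_degree_eq by (rule sum_mono2) auto
  also have "monom_degree m = d" using f m(1) by (auto simp: graded_part_def)
  finally show ?thesis .
qed

lemma v_empty_whisker_graph:
  fixes E :: "'a::{finite,linorder} set set"
  assumes "simple_graph E" "\<And>i. \<not> isolated_vertex E i"
  shows "v_empty TYPE('k::field) (whisker_graph E) = CARD('a)"
  unfolding v_empty_def
proof (rule Least_equality)
  let ?f = "\<Prod>i\<in>UNIV. indet (X (Orig i)) :: ('a whisker_vertex, 'k) polyring"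
  show "\<exists>f :: ('a whisker_vertex, 'k) polyring. f \<in> graded_part (int (CARD('a))) \<and>
      colon (binomial_edge_ideal (whisker_graph E)) f = P_empty (whisker_graph E)"
    by (intro exI[of _ ?f] conjI prod_indet_graded colon_prod_Orig finite)
next
  fix d
  assume "\<exists>f :: ('a whisker_vertex, 'k) polyring. f \<in> graded_part (int d) \<and>
      colon (binomial_edge_ideal (whisker_graph E)) f = P_empty (whisker_graph E)"
  then show "CARD('a) \<le> d" using degree_ge_of_colon_eq_P_empty[OF assms] by (elim exE conjE)
qed

section \<open>A regular sequence inside the binomial edge ideal\<close>

text \<open>The monomials that vanish in
$N_A = S/\bigl((y_{v_i}, x_{u_i} \mid i) + (x_{v_i} y_{u_i} \mid i \in A)\bigr)$. The modules $N_A$ are the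
coefficients of all cocycles below; $N_\emptyset$ is the polynomial ring $T$, and adding an
element $i$ to $A$ divides by $f_{v_i u_i}$. Facts about the ideal are abbreviated by
\<open>mq\<close>.\<close>

definition killed_monomial :: "'a set \<Rightarrow> ('a whisker_vertex var \<Rightarrow>\<^sub>0 nat) \<Rightarrow> bool" where
  "killed_monomial A m \<longleftrightarrow>
     (\<exists>i. 0 < lookup m (Y (Orig i)) \<or> 0 < lookup m (X (Leaf i))) \<or>
     (\<exists>i\<in>A. 0 < lookup m (X (Orig i)) \<and> 0 < lookup m (Y (Leaf i)))"

definition monomial_quotient_ideal :: "'a set \<Rightarrow> ('a whisker_vertex, 'k::field) polyring set" where
  "monomial_quotient_ideal A = {p. \<forall>m\<in>Poly_Mapping.keys p. killed_monomial A m}"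

lemma killed_monomialI:
  "0 < lookup m (Y (Orig i)) \<Longrightarrow> killed_monomial A m"
  "0 < lookup m (X (Leaf i)) \<Longrightarrow> killed_monomial A m"
  "i \<in> A \<Longrightarrow> 0 < lookup m (X (Orig i)) \<Longrightarrow> 0 < lookup m (Y (Leaf i)) \<Longrightarrow> killed_monomial A m"
  unfolding killed_monomial_def by blast+

lemma killed_monomial_add: "killed_monomial A m \<Longrightarrow> killed_monomial A (m + n)"
  by (auto simp: killed_monomial_def lookup_add)

lemma killed_monomial_mono: "killed_monomial A m \<Longrightarrow> A \<subseteq> B \<Longrightarrow> killed_monomial B m"
  by (auto simp: killed_monomial_def)

context
  fixes A :: "'a set"
begin

lemma mq_zero: "(0 :: ('a whisker_vertex, 'k::field) polyring) \<in> monomial_quotient_ideal A"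
  by (simp add: monomial_quotient_ideal_def)

lemma mq_add:
  "p \<in> monomial_quotient_ideal A \<Longrightarrow> q \<in> monomial_quotient_ideal A \<Longrightarrow> p + q \<in> monomial_quotient_ideal A"
  using keys_add[of p q] unfolding monomial_quotient_ideal_def by blast

lemma mq_uminus: "p \<in> monomial_quotient_ideal A \<Longrightarrow> - p \<in> monomial_quotient_ideal A"
  by (simp add: monomial_quotient_ideal_def in_keys_iff)

lemma mq_diff:
  "p \<in> monomial_quotient_ideal A \<Longrightarrow> q \<in> monomial_quotient_ideal A \<Longrightarrow> p - q \<in> monomial_quotient_ideal A"
  using mq_add[of p "- q"] mq_uminus[of q] by simp

lemma mq_mult_right: "p \<in> monomial_quotient_ideal A \<Longrightarrow> p * q \<in> monomial_quotient_ideal A"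
  unfolding monomial_quotient_ideal_def
proof (intro CollectI ballI)
  fix m assume "p \<in> {p. \<forall>m\<in>Poly_Mapping.keys p. killed_monomial A m}" "m \<in> Poly_Mapping.keys (p * q)"
  moreover obtain a b where "m = a + b" "a \<in> Poly_Mapping.keys p"
    using keys_mult calculation(2) by blast
  ultimately show "killed_monomial A m" by (simp add: killed_monomial_add)
qed

lemma mq_mult_left: "p \<in> monomial_quotient_ideal A \<Longrightarrow> q * p \<in> monomial_quotient_ideal A"
  using mq_mult_right[of p q] by (simp add: mult.commute)

lemma mq_sum: "(\<And>x. x \<in> F \<Longrightarrow> g x \<in> monomial_quotient_ideal A) \<Longrightarrow> sum g F \<in> monomial_quotient_ideal A"
  by (induction F rule: infinite_finite_induct) (auto simp: mq_zero mq_add)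

lemma mq_single: "killed_monomial A m \<Longrightarrow> Poly_Mapping.single m c \<in> monomial_quotient_ideal A"
  by (simp add: monomial_quotient_ideal_def)

end

lemma mq_mono: "A \<subseteq> B \<Longrightarrow> p \<in> monomial_quotient_ideal A \<Longrightarrow> p \<in> monomial_quotient_ideal B"
  unfolding monomial_quotient_ideal_def using killed_monomial_mono by blast

lemma one_notin_mq: "1 \<notin> monomial_quotient_ideal A"
  by (simp add: monomial_quotient_ideal_def killed_monomial_def)

abbreviation whisker_binomial :: "'a \<Rightarrow> ('a whisker_vertex, 'k::field) polyring" where
  "whisker_binomial i \<equiv> edge_binomial (Orig i) (Leaf i)"

abbreviation whisker_monomial :: "'a \<Rightarrow> 'a whisker_vertex var \<Rightarrow>\<^sub>0 nat" where
  "whisker_monomial i \<equiv> Poly_Mapping.single (X (Orig i)) 1 + Poly_Mapping.single (Y (Leaf i)) 1"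

lemma whisker_binomial_congruent:
  "whisker_binomial i * p - Poly_Mapping.single (whisker_monomial i) 1 * p \<in> monomial_quotient_ideal A"
proof -
  have "Poly_Mapping.single (Poly_Mapping.single (X (Leaf i)) 1 + Poly_Mapping.single (Y (Orig i)) 1) 1 * p
    \<in> monomial_quotient_ideal A"
    by (intro mq_mult_right mq_single killed_monomialI(1)[of _ i]) (simp add: lookup_add)
  from mq_uminus[OF this] show ?thesis by (simp add: edge_binomial_eq left_diff_distrib)
qed

lemma whisker_binomial_in_mq: "i \<in> A \<Longrightarrow> whisker_binomial i \<in> monomial_quotient_ideal A"
  unfolding edge_binomial_eq
  by (intro mq_diff mq_single killed_monomialI(3)[of i A] killed_monomialI(1)[of "_ + Poly_Mapping.single (Y (Orig i)) 1" i])
    (simp_all add: lookup_add)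

text \<open>Every term of $f_{v_i v_j}$ contains some $y_v$, so only the whisker edges survive, and these are
killed for $A$ the set of all vertices.\<close>

lemma binomial_edge_ideal_subset_mq:
  fixes p :: "('a::linorder whisker_vertex, 'k::field) polyring"
  assumes "p \<in> binomial_edge_ideal (whisker_graph E)"
  shows "p \<in> monomial_quotient_ideal UNIV"
  using assms unfolding binomial_edge_ideal_def
proof (induction rule: ideal_gen_induct)
  case (step c x y)
  then obtain p q where x: "x = edge_binomial p q" and pq: "{p, q} \<in> whisker_graph E" "p < q" by blast
  have "x \<in> monomial_quotient_ideal UNIV"
  proof (cases p)
    case (Leaf i)
    then show ?thesis using pq by (simp add: whisker_edge_Leaf less_whisker_vertex_def)
  next
    case p: (Orig i)
    show ?thesis
    proof (cases q)
      case (Leaf j)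
      then show ?thesis using p pq(1) by (simp add: x whisker_edge_Leaf' whisker_binomial_in_mq)
    next
      case (Orig j)
      show ?thesis unfolding x p Orig edge_binomial_eq
        by (intro mq_diff mq_single, rule killed_monomialI(1)[of _ j], simp add: lookup_add,
            rule killed_monomialI(1)[of _ i], simp add: lookup_add)
    qed
  qed
  then show ?case using step.IH by (intro mq_add mq_mult_left)
qed (rule mq_zero)

text \<open>On $N_A$ the binomial $f_{v_i u_i}$ acts as the monomial $x_{v_i} y_{u_i}$, whose variables do
not occur in the remaining relations when $i \notin A$.\<close>

lemma whisker_binomial_nonzerodivisor:
  assumes "i \<notin> A" "whisker_binomial i * p \<in> monomial_quotient_ideal A"
  shows "p \<in> monomial_quotient_ideal A"
proof -
  let ?s = "whisker_monomial i"
  have "Poly_Mapping.single ?s 1 * p \<in> monomial_quotient_ideal A"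
    using mq_diff[OF assms(2) whisker_binomial_congruent[of i p A]] by simp
  then have *: "killed_monomial A (?s + m)" if "m \<in> Poly_Mapping.keys p" for m
    using that by (auto simp: monomial_quotient_ideal_def in_keys_iff lookup_single_mult_add)
  have "killed_monomial A m" if "killed_monomial A (?s + m)" for m
    using that assms(1) by (auto simp: killed_monomial_def lookup_add lookup_single when_def split: if_splits)
  with * show ?thesis by (simp add: monomial_quotient_ideal_def)
qed

text \<open>Exactness of $N_A \to N_A \to N_{A \cup \{i\}}$, where the first map multiplies by the quadric
$f_{v_i u_i}$. The preimage is obtained by dividing each term that is killed only by the new
relation, so it inherits homogeneity, with the degree lowered by 2.\<close>

lemma mq_insert_division:
  assumes "p \<in> monomial_quotient_ideal (insert i A)"
  obtains q :: "('a::finite whisker_vertex, 'k::field) polyring"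
  where "p - whisker_binomial i * q \<in> monomial_quotient_ideal A"
    and "\<And>d. p \<in> graded_part d \<Longrightarrow> q \<in> graded_part (d - 2)"
proof -
  let ?s = "whisker_monomial i"
  define t where "t m = (if killed_monomial A m then 0 else Poly_Mapping.single (m - ?s) (lookup p m))" for m
  define q where "q = (\<Sum>m\<in>Poly_Mapping.keys p. t m)"
  have s: "?s + (m - ?s) = m" if "m \<in> Poly_Mapping.keys p" "\<not> killed_monomial A m" for m
  proof -
    have "killed_monomial (insert i A) m" using assms that(1) by (simp add: monomial_quotient_ideal_def)
    then have "0 < lookup m (X (Orig i))" "0 < lookup m (Y (Leaf i))"
      using that(2) by (auto simp: killed_monomial_def)
    then show ?thesis
      by (intro poly_mapping_eqI) (auto simp: lookup_add lookup_minus lookup_single when_def)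
  qed
  have "Poly_Mapping.single m (lookup p m) - whisker_binomial i * t m \<in> monomial_quotient_ideal A"
    if "m \<in> Poly_Mapping.keys p" for m
  proof (cases "killed_monomial A m")
    case True
    then show ?thesis by (simp add: t_def mq_single)
  next
    case False
    have "Poly_Mapping.single ?s 1 * t m = Poly_Mapping.single m (lookup p m)"
      using False s[OF that False] by (simp add: t_def mult_single)
    then show ?thesis using mq_uminus[OF whisker_binomial_congruent[of i "t m" A]] by simp
  qed
  then have "(\<Sum>m\<in>Poly_Mapping.keys p. Poly_Mapping.single m (lookup p m) - whisker_binomial i * t m) \<in> monomial_quotient_ideal A"
    by (rule mq_sum)
  also have "(\<Sum>m\<in>Poly_Mapping.keys p. Poly_Mapping.single m (lookup p m) - whisker_binomial i * t m) = p - whisker_binomial i * q"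
    unfolding q_def sum_subtractf sum_distrib_left[symmetric] poly_eq_sum_single[of p, symmetric] by (rule refl)
  finally have 1: "p - whisker_binomial i * q \<in> monomial_quotient_ideal A" .
  have 2: "q \<in> graded_part (d - 2)" if p: "p \<in> graded_part d" for d
  proof -
    have t: "t m \<in> graded_part (d - 2)" if "m \<in> Poly_Mapping.keys p" for m
    proof (cases "killed_monomial A m")
      case False
      have "monom_degree (?s + (m - ?s)) = 2 + monom_degree (m - ?s)"
        by (simp only: monom_degree_add monom_degree_single)
      moreover have "int (monom_degree m) = d" using p that by (simp add: graded_part_def)
      ultimately have "int (monom_degree (m - ?s)) = d - 2" using s[OF that False] by simp
      then show ?thesis using False by (simp add: t_def graded_part_single del: One_nat_def)
    qed (simp add: t_def)
    have "finite B \<Longrightarrow> B \<subseteq> Poly_Mapping.keys p \<Longrightarrow> sum t B \<in> graded_part (d - 2)" for B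
      by (induction B rule: finite_induct) (auto simp: graded_part_add t)
    then show ?thesis unfolding q_def by simp
  qed
  show thesis using that 1 2 by blast
qed

section \<open>Cohomology of a resolution with coefficients in the quotients\<close>

definition entries_in :: "'r set \<Rightarrow> 'r mat \<Rightarrow> bool" where
  "entries_in I A \<longleftrightarrow> (\<forall>i<dim_row A. \<forall>j<dim_col A. A $$ (i, j) \<in> I)"

abbreviation mq_mat :: "'a set \<Rightarrow> ('a whisker_vertex, 'k::field) polyring mat \<Rightarrow> bool" where
  "mq_mat A \<equiv> entries_in (monomial_quotient_ideal A)"

lemma mq_mat_zero: "mq_mat A (0\<^sub>m n m)"
  by (simp add: entries_in_def mq_zero)

lemma mq_mat_add: "P \<in> carrier_mat n m \<Longrightarrow> Q \<in> carrier_mat n m \<Longrightarrow> mq_mat A P \<Longrightarrow> mq_mat A Q \<Longrightarrow> mq_mat A (P + Q)"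
  by (auto simp: entries_in_def intro!: mq_add)

lemma mq_mat_diff: "P \<in> carrier_mat n m \<Longrightarrow> Q \<in> carrier_mat n m \<Longrightarrow> mq_mat A P \<Longrightarrow> mq_mat A Q \<Longrightarrow> mq_mat A (P - Q)"
  by (auto simp: entries_in_def intro!: mq_diff)

lemma mq_mat_mult: "P \<in> carrier_mat n m \<Longrightarrow> Q \<in> carrier_mat m l \<Longrightarrow> mq_mat A P \<Longrightarrow> mq_mat A (P * Q)"
  by (auto simp: entries_in_def scalar_prod_def intro!: mq_sum mq_mult_right)

lemma mq_mat_smult: "a \<in> monomial_quotient_ideal A \<Longrightarrow> mq_mat A (a \<cdot>\<^sub>m P)"
  by (auto simp: entries_in_def intro!: mq_mult_right)

lemma mq_mat_mono: "mq_mat A P \<Longrightarrow> A \<subseteq> B \<Longrightarrow> mq_mat B P"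
  unfolding entries_in_def using mq_mono by blast

lemma mq_mat_nonzerodivisor: "i \<notin> A \<Longrightarrow> mq_mat A (whisker_binomial i \<cdot>\<^sub>m P) \<Longrightarrow> mq_mat A P"
  by (auto simp: entries_in_def intro: whisker_binomial_nonzerodivisor)

lemma mq_mat_insert_division:
  fixes P :: "('a::finite whisker_vertex, 'k::field) polyring mat"
  assumes P: "P \<in> carrier_mat 1 m" and "mq_mat (insert i A) P"
  obtains Q where "Q \<in> carrier_mat 1 m" "mq_mat A (P - whisker_binomial i \<cdot>\<^sub>m Q)"
    "\<And>j d. j < m \<Longrightarrow> P $$ (0, j) \<in> graded_part d \<Longrightarrow> Q $$ (0, j) \<in> graded_part (d - 2)"
proof -
  have "\<exists>q. P $$ (0, j) - whisker_binomial i * q \<in> monomial_quotient_ideal A \<and>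
      (\<forall>d. P $$ (0, j) \<in> graded_part d \<longrightarrow> q \<in> graded_part (d - 2))" if "j < m" for j
  proof -
    have "P $$ (0, j) \<in> monomial_quotient_ideal (insert i A)"
      using assms that by (auto simp: entries_in_def)
    then show ?thesis by (rule mq_insert_division) blast
  qed
  then obtain q where q: "\<And>j. j < m \<Longrightarrow> P $$ (0, j) - whisker_binomial i * q j \<in> monomial_quotient_ideal A"
      "\<And>j d. j < m \<Longrightarrow> P $$ (0, j) \<in> graded_part d \<Longrightarrow> q j \<in> graded_part (d - 2)"
    by metis
  show thesis
  proof (rule that[of "mat 1 m (\<lambda>(_, j). q j)"])
    show "mq_mat A (P - whisker_binomial i \<cdot>\<^sub>m mat 1 m (\<lambda>(_, j). q j))"
      using P q(1) by (auto simp: entries_in_def)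
  qed (use q(2) in auto)
qed

text \<open>A free resolution of a module annihilated by \<open>J\<close>, with free modules $F_k$, extended by a
zero module: \<open>rk\<close> of \<open>Suc k\<close> is the rank of $F_k$, and \<open>\<psi>\<close> of \<open>Suc k\<close> is the map
$F_{k+1} \to F_k$, while \<open>\<psi> 0\<close> has target 0. With this shift the start of every induction is an
instance of the general formula. The last assumption is the annihilation: $a F_0$ lies in the
image of $F_1$ for $a \in J$.\<close>

locale acyclic_complex =
  fixes rk :: "nat \<Rightarrow> nat" and \<psi> :: "nat \<Rightarrow> 'r::comm_ring_1 mat" and J :: "'r set"
  assumes rk0: "rk 0 = 0"
    and \<psi>_carrier: "\<psi> k \<in> carrier_mat (rk k) (rk (Suc k))"
    and complex: "\<psi> k * \<psi> (Suc k) = 0\<^sub>m (rk k) (rk (Suc (Suc k)))"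
    and exact: "U \<in> carrier_mat (rk (Suc (Suc k))) m \<Longrightarrow> \<psi> (Suc k) * U = 0\<^sub>m (rk (Suc k)) m \<Longrightarrow>
      \<exists>W\<in>carrier_mat (rk (Suc (Suc (Suc k)))) m. U = \<psi> (Suc (Suc k)) * W"
    and annihilate: "a \<in> J \<Longrightarrow> \<exists>W\<in>carrier_mat (rk 2) (rk 1). \<psi> 1 * W = a \<cdot>\<^sub>m 1\<^sub>m (rk 1)"
begin

text \<open>Multiplication by $a \in J$ is zero on the resolved module, hence null-homotopic on the
resolution. The maps of the homotopy are found one after the other: the defect
$a - H_k \psi_k$ of the next degree is mapped to zero, so exactness provides a lift.\<close>

lemma homotopy:
  assumes "a \<in> J"
  obtains H where "\<And>k. H k \<in> carrier_mat (rk (Suc k)) (rk k)"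
    and "\<And>k. \<psi> (Suc k) * H (Suc k) + H k * \<psi> k = a \<cdot>\<^sub>m 1\<^sub>m (rk (Suc k))"
proof -
  define good where "good k H W \<longleftrightarrow> W \<in> carrier_mat (rk (Suc (Suc k))) (rk (Suc k)) \<and>
    \<psi> (Suc k) * W + H * \<psi> k = a \<cdot>\<^sub>m 1\<^sub>m (rk (Suc k))" for k H W
  have "\<exists>H. \<forall>k. (H k \<in> carrier_mat (rk (Suc k)) (rk k) \<and> (\<exists>W. good k (H k) W)) \<and> good k (H k) (H (Suc k))"
  proof (rule dependent_nat_choice)
    obtain W where W: "W \<in> carrier_mat (rk 2) (rk 1)" "\<psi> 1 * W = a \<cdot>\<^sub>m 1\<^sub>m (rk 1)"
      using annihilate[OF assms] by blast
    have "0\<^sub>m (rk 1) 0 * \<psi> 0 = 0\<^sub>m (rk 1) (rk 1)"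
      using \<psi>_carrier[of 0] rk0 by (intro eq_matI) (auto simp: scalar_prod_def)
    then have "good 0 (0\<^sub>m (rk 1) 0) W"
      using W by (simp add: good_def numeral_2_eq_2)
    then show "\<exists>H. H \<in> carrier_mat (rk (Suc 0)) (rk 0) \<and> (\<exists>W. good 0 H W)"
      using rk0 by (intro exI[of _ "0\<^sub>m (rk 1) 0"]) auto
  next
    fix H k
    assume *: "H \<in> carrier_mat (rk (Suc k)) (rk k) \<and> (\<exists>W. good k H W)"
    then obtain W where W: "W \<in> carrier_mat (rk (Suc (Suc k))) (rk (Suc k))"
      and eq: "\<psi> (Suc k) * W + H * \<psi> k = a \<cdot>\<^sub>m 1\<^sub>m (rk (Suc k))" by (auto simp: good_def)
    let ?\<psi> = "\<psi> (Suc k)" and ?n = "rk (Suc (Suc k))"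
    note c = \<psi>_carrier[of k] \<psi>_carrier[of "Suc k"] W conjunct1[OF *]
    have "a \<cdot>\<^sub>m ?\<psi> = (?\<psi> * W + H * \<psi> k) * ?\<psi>"
      using c by (simp add: eq mult_smult_assoc_mat[of _ "rk (Suc k)" "rk (Suc k)" _ ?n])
    also have "\<dots> = ?\<psi> * W * ?\<psi> + H * \<psi> k * ?\<psi>"
      using c by (intro add_mult_distrib_mat[where n = "rk (Suc k)"]) auto
    also have "H * \<psi> k * ?\<psi> = 0\<^sub>m (rk (Suc k)) ?n"
      using c complex[of k] by (simp add: assoc_mult_mat[of H _ _ "\<psi> k" _ ?\<psi>])
    also have "?\<psi> * W * ?\<psi> + 0\<^sub>m (rk (Suc k)) ?n = ?\<psi> * (W * ?\<psi>)"
      using c by (simp add: assoc_mult_mat[of ?\<psi> _ _ W _ ?\<psi>])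
    finally have "a \<cdot>\<^sub>m ?\<psi> = ?\<psi> * (W * ?\<psi>)" .
    moreover have "?\<psi> * (a \<cdot>\<^sub>m 1\<^sub>m ?n - W * ?\<psi>) = ?\<psi> * (a \<cdot>\<^sub>m 1\<^sub>m ?n) - ?\<psi> * (W * ?\<psi>)"
      using c by (intro mult_minus_distrib_mat[where nc = ?n]) auto
    moreover have "?\<psi> * (a \<cdot>\<^sub>m 1\<^sub>m ?n) = a \<cdot>\<^sub>m ?\<psi>"
      using c by (simp add: mult_smult_distrib[of _ "rk (Suc k)" ?n _ ?n])
    ultimately have "?\<psi> * (a \<cdot>\<^sub>m 1\<^sub>m ?n - W * ?\<psi>) = 0\<^sub>m (rk (Suc k)) ?n"
      using c by (intro eq_matI) auto
    moreover have "a \<cdot>\<^sub>m 1\<^sub>m ?n - W * ?\<psi> \<in> carrier_mat ?n ?n" using c by auto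
    ultimately obtain W' where W': "W' \<in> carrier_mat (rk (Suc (Suc (Suc k)))) ?n"
      "a \<cdot>\<^sub>m 1\<^sub>m ?n - W * ?\<psi> = \<psi> (Suc (Suc k)) * W'" using exact by metis
    have "\<psi> (Suc (Suc k)) * W' + W * ?\<psi> = a \<cdot>\<^sub>m 1\<^sub>m ?n"
      using c by (intro eq_matI) (auto simp flip: W'(2))
    then show "\<exists>W. (W \<in> carrier_mat (rk (Suc (Suc k))) (rk (Suc k)) \<and> (\<exists>V. good (Suc k) W V)) \<and> good k H W"
      using W W'(1) eq unfolding good_def by blast
  qed
  then obtain H where H: "\<And>k. H k \<in> carrier_mat (rk (Suc k)) (rk k)" "\<And>k. good k (H k) (H (Suc k))" by blast
  show thesis by (rule that[of H]) (use H in \<open>auto simp: good_def\<close>)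
qed

end

locale whisker_complex = acyclic_complex rk \<psi> "binomial_edge_ideal (whisker_graph E)"
  for E :: "'a::{finite,linorder} set set" and rk
    and \<psi> :: "nat \<Rightarrow> ('a whisker_vertex, 'k::field) polyring mat"
begin

lemma whisker_binomial_in_ideal: "whisker_binomial i \<in> (binomial_edge_ideal (whisker_graph E) :: ('a whisker_vertex, 'k) polyring set)"
  by (intro edge_binomial_in_binomial_edge_ideal) (simp add: whisker_edge_Leaf')

lemma mult_\<psi>_0: "u \<in> carrier_mat 1 (rk 0) \<Longrightarrow> u * \<psi> 0 = 0\<^sub>m 1 (rk 1)"
  using \<psi>_carrier[of 0] rk0 by (intro eq_matI) (auto simp: scalar_prod_def)

text \<open>The homotopy shows that $f_{v_i u_i}$ annihilates the cohomology.\<close>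

lemma whisker_binomial_times_cocycle:
  assumes s: "s \<in> carrier_mat 1 (rk (Suc k))" and cocycle: "mq_mat A (s * \<psi> (Suc k))"
  obtains u where "u \<in> carrier_mat 1 (rk k)" "mq_mat A (whisker_binomial i \<cdot>\<^sub>m s - u * \<psi> k)"
proof -
  let ?a = "whisker_binomial i :: ('a whisker_vertex, 'k) polyring"
  obtain H where H: "\<And>k. H k \<in> carrier_mat (rk (Suc k)) (rk k)"
    "\<And>k. \<psi> (Suc k) * H (Suc k) + H k * \<psi> k = ?a \<cdot>\<^sub>m 1\<^sub>m (rk (Suc k))"
    using homotopy[OF whisker_binomial_in_ideal[of i]] by blast
  note c = s H(1)[of k] H(1)[of "Suc k"] \<psi>_carrier[of k] \<psi>_carrier[of "Suc k"]
  have "?a \<cdot>\<^sub>m s = s * (?a \<cdot>\<^sub>m 1\<^sub>m (rk (Suc k)))"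
    using c by (simp add: mult_smult_distrib[of _ 1 "rk (Suc k)" _ "rk (Suc k)"])
  also have "\<dots> = s * (\<psi> (Suc k) * H (Suc k)) + s * (H k * \<psi> k)"
    unfolding H(2)[symmetric] using c by (intro mult_add_distrib_mat[where n = "rk (Suc k)"]) auto
  also have "s * (\<psi> (Suc k) * H (Suc k)) = s * \<psi> (Suc k) * H (Suc k)"
    by (rule assoc_mult_mat[symmetric]) (use c in auto)
  also have "s * (H k * \<psi> k) = s * H k * \<psi> k"
    by (rule assoc_mult_mat[symmetric]) (use c in auto)
  finally have "?a \<cdot>\<^sub>m s - s * H k * \<psi> k = s * \<psi> (Suc k) * H (Suc k)"
    using c by (intro eq_matI) auto
  moreover have "mq_mat A (s * \<psi> (Suc k) * H (Suc k))"
    by (rule mq_mat_mult[OF _ _ cocycle]) (use c in auto)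
  ultimately have "mq_mat A (?a \<cdot>\<^sub>m s - s * H k * \<psi> k)" by simp
  then show thesis using c by (intro that[of "s * H k"]) auto
qed

text \<open>$\mathrm{Ext}^k(S/J, N_A) = 0$ if more than $k$ of the $f_{v_i u_i}$ form a regular sequence on
$N_A$. For $i \notin A$, a multiple $f_{v_i u_i} s$ is the coboundary of some $u$ by the preceding
lemma; then $u$ is a cocycle with values in $N_{A \cup \{i\}}$, so by induction $u$ is there a
coboundary. Thus $u$ may be replaced by a multiple of $f_{v_i u_i}$, which cancels because it is a
nonzerodivisor.\<close>

lemma cocycle_is_coboundary:
  assumes "s \<in> carrier_mat 1 (rk (Suc k))" "mq_mat A (s * \<psi> (Suc k))" "k < card (- A)"
  shows "\<exists>t\<in>carrier_mat 1 (rk k). mq_mat A (s - t * \<psi> k)"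
  using assms
proof (induction k arbitrary: s A)
  case (0 s A)
  have "- A \<noteq> {}" using 0(3) by auto
  then obtain i where i: "i \<notin> A" by auto
  obtain u where u: "u \<in> carrier_mat 1 (rk 0)" "mq_mat A (whisker_binomial i \<cdot>\<^sub>m s - u * \<psi> 0)"
    by (rule whisker_binomial_times_cocycle[OF 0(1,2)])
  have "whisker_binomial i \<cdot>\<^sub>m s - u * \<psi> 0 = whisker_binomial i \<cdot>\<^sub>m s"
    using 0(1) unfolding mult_\<psi>_0[OF u(1)] by (intro eq_matI) auto
  then have "mq_mat A s" using u(2) i by (auto intro: mq_mat_nonzerodivisor)
  moreover have "s - u * \<psi> 0 = s" using 0(1) unfolding mult_\<psi>_0[OF u(1)] by (intro eq_matI) auto
  ultimately show ?case using u(1) by (intro bexI[of _ u]) simp_all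
next
  case (Suc k s A)
  have "- A \<noteq> {}" using Suc.prems(3) by auto
  then obtain i where i: "i \<notin> A" by auto
  let ?a = "whisker_binomial i :: ('a whisker_vertex, 'k) polyring" and ?P = "\<psi> (Suc k)"
  obtain u where u: "u \<in> carrier_mat 1 (rk (Suc k))" "mq_mat A (?a \<cdot>\<^sub>m s - u * ?P)"
    by (rule whisker_binomial_times_cocycle[OF Suc.prems(1,2)])
  note c = Suc.prems(1) u(1) \<psi>_carrier[of k] \<psi>_carrier[of "Suc k"]
  have "mq_mat (insert i A) (?a \<cdot>\<^sub>m s - (?a \<cdot>\<^sub>m s - u * ?P))"
    by (rule mq_mat_diff[where n = 1 and m = "rk (Suc (Suc k))"])
      (use c u(2) in \<open>auto intro: mq_mat_smult whisker_binomial_in_mq mq_mat_mono\<close>)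
  also have "?a \<cdot>\<^sub>m s - (?a \<cdot>\<^sub>m s - u * ?P) = u * ?P" using c by (intro eq_matI) auto
  finally have uP: "mq_mat (insert i A) (u * ?P)" .
  have "k < card (- insert i A)"
    using Suc.prems(3) i by (simp add: Compl_insert card_Diff_singleton)
  from Suc.IH[OF u(1) uP this] obtain t where t: "t \<in> carrier_mat 1 (rk k)" "mq_mat (insert i A) (u - t * \<psi> k)"
    by blast
  have "u - t * \<psi> k \<in> carrier_mat 1 (rk (Suc k))" using c t(1) by auto
  then obtain v where v: "v \<in> carrier_mat 1 (rk (Suc k))" "mq_mat A (u - t * \<psi> k - ?a \<cdot>\<^sub>m v)"
    using t(2) by (rule mq_mat_insert_division)
  have "mq_mat A ((u - t * \<psi> k - ?a \<cdot>\<^sub>m v) * ?P)"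
    by (rule mq_mat_mult[OF _ _ v(2)]) (use c t(1) v(1) in auto)
  also have "(u - t * \<psi> k - ?a \<cdot>\<^sub>m v) * ?P = (u - t * \<psi> k) * ?P - ?a \<cdot>\<^sub>m v * ?P"
    by (rule minus_mult_distrib_mat) (use c t(1) v(1) in auto)
  also have "(u - t * \<psi> k) * ?P = u * ?P - t * \<psi> k * ?P"
    by (rule minus_mult_distrib_mat) (use c t(1) in auto)
  also have "t * \<psi> k * ?P = t * (\<psi> k * ?P)"
    by (rule assoc_mult_mat) (use c t(1) in auto)
  also have "\<dots> = 0\<^sub>m 1 (rk (Suc (Suc k)))" using t(1) by (simp add: complex)
  also have "u * ?P - 0\<^sub>m 1 (rk (Suc (Suc k))) = u * ?P" using c by (intro eq_matI) auto
  also have "?a \<cdot>\<^sub>m v * ?P = ?a \<cdot>\<^sub>m (v * ?P)"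
    by (rule mult_smult_assoc_mat) (use c v(1) in auto)
  finally have uv: "mq_mat A (u * ?P - ?a \<cdot>\<^sub>m (v * ?P))" .
  have "mq_mat A ((?a \<cdot>\<^sub>m s - u * ?P) + (u * ?P - ?a \<cdot>\<^sub>m (v * ?P)))"
    by (rule mq_mat_add[OF _ _ u(2) uv]) (use c v(1) in auto)
  also have "(?a \<cdot>\<^sub>m s - u * ?P) + (u * ?P - ?a \<cdot>\<^sub>m (v * ?P)) = ?a \<cdot>\<^sub>m (s - v * ?P)"
    using c v(1) by (intro eq_matI) (auto simp: right_diff_distrib)
  finally have "mq_mat A (s - v * ?P)" by (rule mq_mat_nonzerodivisor[OF i])
  then show ?case using v(1) by blast
qed

text \<open>The connecting homomorphisms
$\mathrm{Ext}^k(S/J, N_{B \cup \{i\}}) \to \mathrm{Ext}^{k+1}(S/J, N_B)(-2)$ are injective because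
$\mathrm{Ext}^k(S/J, N_B) = 0$. They start from the nonzero map \<open>e\<close> in
$\mathrm{Hom}(S/J, N_A)$ for $A$ the set of all vertices, and after $k$ steps they give a cocycle
on $F_k$ of degree $-2k$ that is not a coboundary.\<close>

lemma nontrivial_cocycle:
  assumes deg: "\<And>k a b. a < rk (Suc k) \<Longrightarrow> b < rk (Suc (Suc k)) \<Longrightarrow> \<psi> (Suc k) $$ (a, b) \<in> graded_part (D (Suc k) b - D k a)"
    and aug: "e \<in> carrier_mat 1 (rk 1)" "\<And>b. b < rk 1 \<Longrightarrow> e $$ (0, b) \<in> graded_part (D 0 b)"
      "mq_mat UNIV (e * \<psi> 1)" "\<not> mq_mat UNIV e"
  shows "k \<le> CARD('a) \<Longrightarrow> \<exists>A s. card (- A) = k \<and> s \<in> carrier_mat 1 (rk (Suc k)) \<and>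
    (\<forall>b<rk (Suc k). s $$ (0, b) \<in> graded_part (D k b - 2 * int k)) \<and> mq_mat A (s * \<psi> (Suc k)) \<and>
    \<not> (\<exists>t\<in>carrier_mat 1 (rk k). mq_mat A (s - t * \<psi> k))"
proof (induction k)
  case 0
  have "\<not> mq_mat UNIV (e - t * \<psi> 0)" if "t \<in> carrier_mat 1 (rk 0)" for t
  proof -
    have "e - t * \<psi> 0 = e" using aug(1) unfolding mult_\<psi>_0[OF that] by (intro eq_matI) auto
    then show ?thesis using aug(4) by simp
  qed
  then show ?case using aug by (intro exI[of _ UNIV] exI[of _ e]) auto
next
  case (Suc k)
  then obtain A s where A: "card (- A) = k" and s: "s \<in> carrier_mat 1 (rk (Suc k))"
    and s_deg: "\<And>b. b < rk (Suc k) \<Longrightarrow> s $$ (0, b) \<in> graded_part (D k b - 2 * int k)"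
    and cocycle: "mq_mat A (s * \<psi> (Suc k))"
    and nontrivial: "\<And>t. t \<in> carrier_mat 1 (rk k) \<Longrightarrow> \<not> mq_mat A (s - t * \<psi> k)" by auto
  have "A \<noteq> {}" using A Suc.prems by auto
  then obtain i where i: "i \<in> A" by blast
  define B where "B = A - {i}"
  have B: "i \<notin> B" "insert i B = A" "B \<subseteq> A" using i by (auto simp: B_def)
  have "- B = insert i (- A)" using i by (auto simp: B_def)
  then have card_B: "card (- B) = Suc k" using A i by simp
  let ?a = "whisker_binomial i :: ('a whisker_vertex, 'k) polyring" and ?P = "\<psi> (Suc k)" and ?Q = "\<psi> (Suc (Suc k))"
  note c = s \<psi>_carrier[of k] \<psi>_carrier[of "Suc k"] \<psi>_carrier[of "Suc (Suc k)"]
  have "s * ?P \<in> carrier_mat 1 (rk (Suc (Suc k)))" using c by auto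
  moreover have "mq_mat (insert i B) (s * ?P)" using cocycle B(2) by simp
  ultimately obtain r where r: "r \<in> carrier_mat 1 (rk (Suc (Suc k)))" "mq_mat B (s * ?P - ?a \<cdot>\<^sub>m r)"
    and r_deg: "\<And>j d. j < rk (Suc (Suc k)) \<Longrightarrow> (s * ?P) $$ (0, j) \<in> graded_part d \<Longrightarrow> r $$ (0, j) \<in> graded_part (d - 2)"
    by (rule mq_mat_insert_division) blast
  have deg_r: "r $$ (0, b) \<in> graded_part (D (Suc k) b - 2 * int (Suc k))" if b: "b < rk (Suc (Suc k))" for b
  proof -
    have summand: "s $$ (0, j) * ?P $$ (j, b) \<in> graded_part (D (Suc k) b - 2 * int k)" if "j < rk (Suc k)" for j
      using graded_part_mult[OF s_deg[OF that] deg[OF that b]] by simp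
    have "(s * ?P) $$ (0, b) = (\<Sum>j<rk (Suc k). s $$ (0, j) * ?P $$ (j, b))"
      using c b by (simp add: scalar_prod_def atLeast0LessThan)
    moreover have "finite F \<Longrightarrow> F \<subseteq> {..<rk (Suc k)} \<Longrightarrow>
        (\<Sum>j\<in>F. s $$ (0, j) * ?P $$ (j, b)) \<in> graded_part (D (Suc k) b - 2 * int k)" for F
      by (induction F rule: finite_induct) (auto intro: graded_part_add summand)
    ultimately have "(s * ?P) $$ (0, b) \<in> graded_part (D (Suc k) b - 2 * int k)" by simp
    from r_deg[OF b this] show ?thesis by (simp add: algebra_simps)
  qed
  have "mq_mat B ((s * ?P - ?a \<cdot>\<^sub>m r) * ?Q)"
    by (rule mq_mat_mult[OF _ _ r(2)]) (use c r(1) in auto)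
  also have "(s * ?P - ?a \<cdot>\<^sub>m r) * ?Q = s * ?P * ?Q - ?a \<cdot>\<^sub>m r * ?Q"
    by (rule minus_mult_distrib_mat) (use c r(1) in auto)
  also have "s * ?P * ?Q = s * (?P * ?Q)" by (rule assoc_mult_mat) (use c in auto)
  also have "\<dots> = 0\<^sub>m 1 (rk (Suc (Suc (Suc k))))" using s by (simp add: complex)
  also have "?a \<cdot>\<^sub>m r * ?Q = ?a \<cdot>\<^sub>m (r * ?Q)"
    by (rule mult_smult_assoc_mat) (use c r(1) in auto)
  also have "0\<^sub>m 1 (rk (Suc (Suc (Suc k)))) - ?a \<cdot>\<^sub>m (r * ?Q) = ?a \<cdot>\<^sub>m (- (r * ?Q))"
    using c r(1) by (intro eq_matI) auto
  finally have "mq_mat B (- (r * ?Q))" by (rule mq_mat_nonzerodivisor[OF B(1)])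
  then have r_cocycle: "mq_mat B (r * ?Q)" using mq_uminus by (fastforce simp: entries_in_def)
  \<comment> \<open>if $r$ were the coboundary of $t$, then $s - f_{v_i u_i} t$ would be a cocycle over $N_B$, hence a coboundary, and so would be $s$ over $N_A$\<close>
  have "\<not> mq_mat B (r - t * ?P)" if t: "t \<in> carrier_mat 1 (rk (Suc k))" for t
  proof
    assume "mq_mat B (r - t * ?P)"
    then have "mq_mat B (?a \<cdot>\<^sub>m (r - t * ?P))" by (auto simp: entries_in_def intro: mq_mult_left)
    then have "mq_mat B ((s * ?P - ?a \<cdot>\<^sub>m r) + ?a \<cdot>\<^sub>m (r - t * ?P))"
      using r(2) by (intro mq_mat_add[where n = 1 and m = "rk (Suc (Suc k))"]) (use c r(1) t in auto)
    also have "(s * ?P - ?a \<cdot>\<^sub>m r) + ?a \<cdot>\<^sub>m (r - t * ?P) = s * ?P - ?a \<cdot>\<^sub>m (t * ?P)"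
      using c r(1) t by (intro eq_matI) (auto simp: right_diff_distrib)
    also have "?a \<cdot>\<^sub>m (t * ?P) = ?a \<cdot>\<^sub>m t * ?P"
      by (rule mult_smult_assoc_mat[symmetric]) (use c t in auto)
    also have "s * ?P - ?a \<cdot>\<^sub>m t * ?P = (s - ?a \<cdot>\<^sub>m t) * ?P"
      by (rule minus_mult_distrib_mat[symmetric]) (use c t in auto)
    finally have "mq_mat B ((s - ?a \<cdot>\<^sub>m t) * ?P)" .
    moreover have "s - ?a \<cdot>\<^sub>m t \<in> carrier_mat 1 (rk (Suc k))" using c t by auto
    ultimately obtain v where v: "v \<in> carrier_mat 1 (rk k)" "mq_mat B (s - ?a \<cdot>\<^sub>m t - v * \<psi> k)"
      using cocycle_is_coboundary[of "s - ?a \<cdot>\<^sub>m t" k B] card_B by auto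
    have "mq_mat A ((s - ?a \<cdot>\<^sub>m t - v * \<psi> k) + ?a \<cdot>\<^sub>m t)"
      by (rule mq_mat_add[OF _ _ mq_mat_mono[OF v(2) B(3)] mq_mat_smult[OF whisker_binomial_in_mq[OF i]]])
        (use c t v(1) in auto)
    also have "(s - ?a \<cdot>\<^sub>m t - v * \<psi> k) + ?a \<cdot>\<^sub>m t = s - v * \<psi> k"
      using c t v(1) by (intro eq_matI) auto
    finally show False using nontrivial[OF v(1)] by simp
  qed
  then show ?case using card_B r(1) deg_r r_cocycle by blast
qed

end

section \<open>Dickson's lemma and a monomial order\<close>

text \<open>Induction on the set of coordinates. Choose a finite set \<open>B0\<close> for the old coordinates and let \<open>N\<close>
bound its new coordinate: elements with a larger new coordinate lie above \<open>B0\<close>,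
and for each of the finitely many smaller values the old coordinates suffice.\<close>

lemma dickson_on:
  assumes "finite Z"
  shows "\<exists>B\<subseteq>A. finite B \<and> (\<forall>a\<in>A. \<exists>b\<in>B. \<forall>z\<in>Z. f b z \<le> (f a z :: nat))"
  using assms
proof (induction Z arbitrary: A rule: finite_induct)
  case empty
  show ?case
  proof (cases "A = {}")
    case False
    then obtain a where "a \<in> A" by blast
    then show ?thesis by (intro exI[of _ "{a}"]) auto
  qed auto
next
  case (insert z Z)
  obtain B0 where B0: "B0 \<subseteq> A" "finite B0" "\<And>a. a \<in> A \<Longrightarrow> \<exists>b\<in>B0. \<forall>z\<in>Z. f b z \<le> f a z"
    using insert.IH[of A] by blast
  obtain N where N: "\<And>b. b \<in> B0 \<Longrightarrow> f b z \<le> N"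
    using finite_nat_set_iff_bounded_le[of "(\<lambda>b. f b z) ` B0"] B0(2) by auto
  have "\<forall>k. \<exists>B\<subseteq>{a \<in> A. f a z = k}. finite B \<and> (\<forall>a\<in>{a \<in> A. f a z = k}. \<exists>b\<in>B. \<forall>z\<in>Z. f b z \<le> f a z)"
    by (rule allI) (rule insert.IH)
  then obtain B where B: "\<forall>k. B k \<subseteq> {a \<in> A. f a z = k} \<and> finite (B k) \<and>
      (\<forall>a\<in>{a \<in> A. f a z = k}. \<exists>b\<in>B k. \<forall>z\<in>Z. f b z \<le> f a z)"
    by (rule choice[THEN exE])
  show ?case
  proof (intro exI[of _ "B0 \<union> (\<Union>k\<le>N. B k)"] conjI ballI)
    fix a assume a: "a \<in> A"
    show "\<exists>b\<in>B0 \<union> (\<Union>k\<le>N. B k). \<forall>z\<in>insert z Z. f b z \<le> f a z"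
    proof (cases "f a z \<le> N")
      case True
      obtain b where b: "b \<in> B (f a z)" "\<forall>z\<in>Z. f b z \<le> f a z"
        using B[rule_format, of "f a z"] a by auto
      moreover have "f b z = f a z" using B[rule_format, of "f a z"] b(1) by auto
      ultimately show ?thesis using True by (intro bexI[of _ b]) auto
    next
      case False
      obtain b where b: "b \<in> B0" "\<forall>z\<in>Z. f b z \<le> f a z" using B0(3)[OF a] by blast
      then have "f b z \<le> f a z" using False N[OF b(1)] by simp
      then show ?thesis using b by auto
    qed
  next
    show "B0 \<union> (\<Union>k\<le>N. B k) \<subseteq> A" using B0(1) B by blast
    show "finite (B0 \<union> (\<Union>k\<le>N. B k))" using B0(2) B by simp
  qed
qed

lemma dickson:
  fixes A :: "('z::finite \<Rightarrow>\<^sub>0 nat) set"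
  obtains B where "B \<subseteq> A" "finite B" "\<And>a. a \<in> A \<Longrightarrow> \<exists>b\<in>B. \<exists>t. a = b + t"
proof -
  obtain B where B: "B \<subseteq> A" "finite B" "\<And>a. a \<in> A \<Longrightarrow> \<exists>b\<in>B. \<forall>z\<in>UNIV. lookup b z \<le> lookup a z"
    using dickson_on[of "UNIV :: 'z set" A lookup] by auto
  have "\<exists>t. a = b + t" if "\<forall>z\<in>UNIV. lookup b z \<le> lookup a z" for a b :: "'z \<Rightarrow>\<^sub>0 nat"
    using that by (intro exI[of _ "a - b"] poly_mapping_eqI) (simp add: lookup_add lookup_minus)
  then show thesis using that B by meson
qed

text \<open>A term order on $\bigoplus_b S$ by Goedel numbering: distinct primes are assigned to the
variables and to the basis elements, and a term is coded by the corresponding product of prime powers. The coding is injective and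
turns multiplication by a monomial into multiplication of natural numbers, so the order of the
natural numbers pulls back to a well-order that is compatible with multiplication.\<close>

lemma exists_term_order:
  obtains tc :: "nat \<Rightarrow> ('z::finite \<Rightarrow>\<^sub>0 nat) \<Rightarrow> nat"
  where "\<And>b m b' m'. tc b m = tc b' m' \<Longrightarrow> b = b' \<and> m = m'"
    and "\<And>b m b' m' t. tc b m < tc b' m' \<Longrightarrow> tc b (m + t) < tc b' (m' + t)"
proof -
  obtain \<pi> :: "nat \<Rightarrow> nat" where \<pi>: "inj \<pi>" "range \<pi> \<subseteq> {p. prime p}"
    using infinite_countable_subset[OF primes_infinite] by blast
  obtain e :: "'z \<Rightarrow> nat" where e: "inj e" using finite_imp_inj_to_nat_seg[OF finite[of "UNIV :: 'z set"]] by auto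
  define p where "p z = \<pi> (2 * e z)" for z
  define q where "q b = \<pi> (2 * b + 1)" for b
  have prime_p: "prime (p z)" and prime_q: "prime (q b)" for z b using \<pi>(2) by (auto simp: p_def q_def)
  have inj_p: "inj p"
    by (rule injI) (use \<pi>(1) e in \<open>simp add: p_def inj_eq\<close>)
  have inj_q: "inj q"
    by (rule injI) (use \<pi>(1) in \<open>simp add: q_def inj_eq\<close>)
  have q_neq_p: "q b \<noteq> p z" for b z
  proof
    assume "q b = p z"
    then have "2 * b + 1 = 2 * e z" using \<pi>(1) by (simp add: p_def q_def inj_eq)
    then show False by presburger
  qed
  define code where "code m = (\<Prod>z\<in>UNIV. p z ^ lookup m z)" for m :: "'z \<Rightarrow>\<^sub>0 nat"
  have code_pos: "0 < code m" for m
    using prime_p by (auto simp: code_def prime_gt_0_nat intro!: prod_pos)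
  have code_add: "code (m + n) = code m * code n" for m n
    by (simp add: code_def lookup_add power_add prod.distrib)
  have code_inj: "m = n" if "code m = code n" for m n
  proof (rule poly_mapping_eqI)
    fix z
    have "multiplicity (p z) (code m) = lookup m z" for m
    proof -
      have "code m = (\<Prod>x\<in>range p. x ^ lookup m (inv_into UNIV p x))"
        unfolding code_def by (subst prod.reindex[OF inj_p]) (simp add: inv_f_f[OF inj_p])
      then show ?thesis
        using multiplicity_prod_prime_powers[of "range p" "p z" "\<lambda>x. lookup m (inv_into UNIV p x)"] prime_p
        by (auto simp: inv_f_f[OF inj_p])
    qed
    then show "lookup m z = lookup n z" using that by metis
  qed
  have q_not_dvd: "\<not> q b dvd code m" for b m
  proof
    assume "q b dvd code m"
    then obtain z where "q b dvd p z ^ lookup m z"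
      unfolding code_def by (subst (asm) prime_dvd_prod_iff) (auto simp: prime_q)
    then have "q b dvd p z" using prime_q prime_dvd_power by blast
    then show False using prime_p prime_q q_neq_p primes_dvd_imp_eq by blast
  qed
  show thesis
  proof (rule that[of "\<lambda>b m. q b * code m"])
    fix b m b' m'
    assume eq: "q b * code m = q b' * code m'"
    then have "q b dvd q b' * code m'" by (metis dvd_triv_left)
    then have "q b dvd q b'" using q_not_dvd prime_q prime_dvd_mult_iff by blast
    then have "q b = q b'" using prime_q primes_dvd_imp_eq by blast
    moreover from this have "code m = code m'" using eq prime_q[of b] by (simp add: prime_gt_0_nat)
    ultimately show "b = b' \<and> m = m'" using code_inj inj_q by (auto dest: injD)
  next
    fix b m b' m' t
    assume "q b * code m < q b' * code m'"
    then have "q b * code m * code t < q b' * code m' * code t" using code_pos[of t] by simp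
    then show "q b * code (m + t) < q b' * code (m' + t)" by (simp add: code_add mult.assoc)
  qed
qed

section \<open>Homogeneous submodules of free modules\<close>

text \<open>Elements of free modules are functions on the natural numbers that vanish beyond the rank; in
this form the general theory of spans applies to them.\<close>

definition vscale :: "'r \<Rightarrow> (nat \<Rightarrow> 'r) \<Rightarrow> nat \<Rightarrow> 'r::comm_ring_1" where
  "vscale c f = (\<lambda>b. c * f b)"

lemma vscale_apply [simp]: "vscale c f b = c * f b"
  by (simp add: vscale_def)

lemma module_vscale: "Modules.module (vscale :: 'r::comm_ring_1 \<Rightarrow> _)"
  by unfold_locales (simp_all add: fun_eq_iff algebra_simps)

abbreviation submodule_gen :: "(nat \<Rightarrow> 'r::comm_ring_1) set \<Rightarrow> (nat \<Rightarrow> 'r) set" where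
  "submodule_gen \<equiv> Modules.module.span vscale"

abbreviation submodule :: "(nat \<Rightarrow> 'r::comm_ring_1) set \<Rightarrow> bool" where
  "submodule \<equiv> Modules.module.subspace vscale"

lemmas submodule_gen_base = Modules.module.span_base[OF module_vscale]
  and submodule_gen_zero = Modules.module.span_zero[OF module_vscale]
  and submodule_gen_add = Modules.module.span_add[OF module_vscale]
  and submodule_gen_scale = Modules.module.span_scale[OF module_vscale]
  and submodule_gen_sum = Modules.module.span_sum[OF module_vscale]
  and submodule_gen_minimal = Modules.module.span_minimal[OF module_vscale]
  and submodule_gen_finite = Modules.module.span_finite[OF module_vscale]
  and submodule_gen_eq = Modules.module.span_eq[OF module_vscale]
  and submoduleI = Modules.module.subspaceI[OF module_vscale]
  and submodule_diff = Modules.module.subspace_diff[OF module_vscale]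
  and submodule_scale = Modules.module.subspace_scale[OF module_vscale]
  and submodule_submodule_gen = Modules.module.subspace_span[OF module_vscale]

text \<open>The component of degree \<open>d\<close> of $\bigoplus_b S(-D_b)$.\<close>

definition hom_vectors :: "int list \<Rightarrow> int \<Rightarrow> (nat \<Rightarrow> ('v, 'k::field) polyring) set" where
  "hom_vectors D d = {f. (\<forall>b<length D. f b \<in> graded_part (d - D ! b)) \<and> (\<forall>b\<ge>length D. f b = 0)}"

text \<open>Hilbert's basis theorem in its graded form. By Dickson's lemma finitely many homogeneous elements
\<open>g b n\<close> have leading terms that divide all others. Every homogeneous element of \<open>U\<close> is reduced to
zero by them, because subtracting a suitable multiple cancels the leading term and thereby
lowers its code.\<close>

lemma finitely_many_homogeneous_generators:
  fixes U :: "(nat \<Rightarrow> ('v::finite, 'k::field) polyring) set"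
  assumes U: "submodule U"
  obtains G where "finite G" "G \<subseteq> U \<inter> (\<Union>d. hom_vectors D d)"
    "U \<inter> (\<Union>d. hom_vectors D d) \<subseteq> submodule_gen G"
proof -
  let ?Hom = "U \<inter> (\<Union>d. hom_vectors D d)"
  obtain tc :: "nat \<Rightarrow> ('v var \<Rightarrow>\<^sub>0 nat) \<Rightarrow> nat"
    where tc_inj: "\<And>b m b' m'. tc b m = tc b' m' \<Longrightarrow> b = b' \<and> m = m'"
      and tc_mono: "\<And>b m b' m' t. tc b m < tc b' m' \<Longrightarrow> tc b (m + t) < tc b' (m' + t)"
    by (rule exists_term_order) blast
  define lead where "lead h b m \<longleftrightarrow> m \<in> Poly_Mapping.keys (h b) \<and>
    (\<forall>b' m'. m' \<in> Poly_Mapping.keys (h b') \<longrightarrow> tc b' m' \<le> tc b m)"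
    for h :: "nat \<Rightarrow> ('v, 'k) polyring" and b m
  have ex_lead: "\<exists>b m. lead h b m" if h: "h \<in> ?Hom" "h \<noteq> 0" for h
  proof -
    let ?T = "{(b, m). m \<in> Poly_Mapping.keys (h b)}"
    have "?T \<subseteq> (SIGMA b : {..<length D}. Poly_Mapping.keys (h b))"
      using h(1) by (auto simp: hom_vectors_def not_less[symmetric])
    then have fin: "finite ?T" by (rule finite_subset) auto
    have "\<exists>b. h b \<noteq> 0" using h(2) by (auto simp: fun_eq_iff)
    then have "?T \<noteq> {}" by (auto simp flip: keys_eq_empty)
    define M where "M = Max ((\<lambda>(b, m). tc b m) ` ?T)"
    have "M \<in> (\<lambda>(b, m). tc b m) ` ?T" unfolding M_def using fin \<open>?T \<noteq> {}\<close> by (intro Max_in) auto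
    then obtain b m where bm: "m \<in> Poly_Mapping.keys (h b)" "tc b m = M" by auto
    have "tc b' m' \<le> M" if "m' \<in> Poly_Mapping.keys (h b')" for b' m'
      unfolding M_def using fin that by (intro Max_ge) auto
    then have "lead h b m" using bm by (simp add: lead_def)
    then show ?thesis by blast
  qed
  define L where "L b = {m. \<exists>h\<in>?Hom. lead h b m}" for b
  have "\<forall>b. \<exists>B. B \<subseteq> L b \<and> finite B \<and> (\<forall>m\<in>L b. \<exists>n\<in>B. \<exists>t. m = n + t)"
    by (intro allI, rule dickson) blast
  then obtain B where B': "\<forall>b. B b \<subseteq> L b \<and> finite (B b) \<and> (\<forall>m\<in>L b. \<exists>n\<in>B b. \<exists>t. m = n + t)"
    by (rule choice[THEN exE])
  have B: "B b \<subseteq> L b" "finite (B b)" for b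
    using B' by simp_all
  have B_divides: "\<exists>n\<in>B b. \<exists>t. m = n + t" if "m \<in> L b" for b m
    using B' that by simp
  have "\<forall>b m. \<exists>h. m \<in> L b \<longrightarrow> h \<in> ?Hom \<and> lead h b m"
    unfolding L_def mem_Collect_eq by blast
  then obtain g where "\<forall>b m. m \<in> L b \<longrightarrow> g b m \<in> ?Hom \<and> lead (g b m) b m"
    unfolding choice_iff by (elim exE)
  then have g: "g b m \<in> ?Hom" "lead (g b m) b m" if "m \<in> B b" for b m
    using subsetD[OF B(1) that] by simp_all
  define G where "G = (\<Union>b<length D. g b ` B b)"
  have "h \<in> submodule_gen G" if hom: "h \<in> ?Hom" for h
  proof (cases "h = 0")
    case False
    then obtain b m where "lead h b m" using ex_lead[OF hom] by blast
    then show ?thesis using hom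
    proof (induction "tc b m" arbitrary: h b m rule: less_induct)
      case less
      obtain d where h: "h \<in> U" "h \<in> hom_vectors D d" using less.prems(2) by blast
      have m: "m \<in> Poly_Mapping.keys (h b)" using less.prems(1) by (simp add: lead_def)
      then have b: "b < length D" using h(2) by (auto simp: hom_vectors_def not_less[symmetric])
      obtain n t where n: "n \<in> B b" and mt: "m = n + t"
      proof -
        have "m \<in> L b" unfolding L_def using less.prems by blast
        from B_divides[OF this] show ?thesis using that by blast
      qed
      let ?g = "g b n"
      obtain d' where gU: "?g \<in> U" "?g \<in> hom_vectors D d'" using g(1)[OF n] by blast
      have lead_g: "lead ?g b n" by (rule g(2)[OF n])
      define c where "c = lookup (h b) m / lookup (?g b) n"
      let ?s = "Poly_Mapping.single t c"
      have nz: "lookup (?g b) n \<noteq> 0" using lead_g by (simp add: lead_def in_keys_iff)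
      have "int (monom_degree m) = d - D ! b" "int (monom_degree n) = d' - D ! b"
        using h(2) gU(2) b m lead_g by (auto simp: hom_vectors_def graded_part_def lead_def)
      then have deg: "int (monom_degree t) + d' = d" unfolding mt monom_degree_add by simp
      define h' where "h' = h - vscale ?s ?g"
      have "?s * ?g a \<in> graded_part (d - D ! a)" if "a < length D" for a
      proof -
        have "?g a \<in> graded_part (d' - D ! a)" using gU(2) that by (simp add: hom_vectors_def)
        from graded_part_mult[OF graded_part_single[OF refl] this, of t c]
        show ?thesis using deg by (simp add: algebra_simps)
      qed
      then have "h' \<in> hom_vectors D d"
        using h(2) gU(2) by (auto simp: h'_def hom_vectors_def intro: graded_part_diff)
      moreover have "h' \<in> U" unfolding h'_def by (intro submodule_diff submodule_scale U h(1) gU(1))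
      ultimately have h': "h' \<in> ?Hom" by blast
      have gG: "?g \<in> submodule_gen G" by (rule submodule_gen_base) (use b n in \<open>auto simp: G_def\<close>)
      have "h' \<in> submodule_gen G"
      proof (cases "h' = 0")
        case False
        then obtain b' m' where lead_h': "lead h' b' m'" using ex_lead[OF h' False] by blast
        then have m': "lookup (h b') m' \<noteq> lookup (?s * ?g b') m'"
          by (simp add: lead_def in_keys_iff h'_def lookup_minus)
        have "tc b' m' \<le> tc b m"
        proof (cases "lookup (h b') m' = 0")
          case False
          then have "m' \<in> Poly_Mapping.keys (h b')" by (simp only: in_keys_iff not_False_eq_True)
          then show ?thesis using less.prems(1) unfolding lead_def by blast
        next
          case True
          then have "m' \<in> Poly_Mapping.keys (?s * ?g b')" using m' by (simp add: in_keys_iff)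
          from subsetD[OF keys_mult this] obtain k n' where
            k: "k \<in> Poly_Mapping.keys ?s" and n: "m' = k + n'" "n' \<in> Poly_Mapping.keys (?g b')" by blast
          have "k = t" using k by (simp split: if_splits)
          with n have n': "m' = t + n'" "n' \<in> Poly_Mapping.keys (?g b')" by simp_all
          have "tc b' n' \<le> tc b n" using lead_g n'(2) unfolding lead_def by blast
          then consider "tc b' n' < tc b n" | "tc b' n' = tc b n" by linarith
          then show ?thesis
          proof cases
            case 1
            from tc_mono[OF this, of t] show ?thesis by (simp add: n'(1) mt add.commute)
          next
            case 2
            from tc_inj[OF this] show ?thesis by (simp add: n'(1) mt add.commute)
          qed
        qed
        moreover have "tc b' m' \<noteq> tc b m"
        proof
          assume "tc b' m' = tc b m"
          from tc_inj[OF this] have eq: "b' = b" "m' = m" by auto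
          have "lookup (?s * ?g b) (t + n) = c * lookup (?g b) n"
            by (rule lookup_single_mult_add)
          then show False using m' nz by (simp add: eq mt c_def add.commute)
        qed
        ultimately have "tc b' m' < tc b m" by simp
        then show ?thesis by (rule less.hyps[OF _ lead_h' h'])
      qed (use submodule_gen_zero in auto)
      from submodule_gen_add[OF this submodule_gen_scale[OF gG, of ?s]]
      show ?case by (simp add: h'_def)
    qed
  qed (use submodule_gen_zero in auto)
  moreover have "finite G" "G \<subseteq> ?Hom" using B(2) g(1) by (auto simp: G_def)
  ultimately show thesis using that by blast
qed

section \<open>Minimal presentations\<close>

lemma sum_fun_apply: "(\<Sum>i\<in>I. g i) x = (\<Sum>i\<in>I. g i x :: 'b::comm_monoid_add)"
  by (induction I rule: infinite_finite_induct) simp_all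

definition hom_part :: "int \<Rightarrow> ('v, 'k::field) polyring \<Rightarrow> ('v, 'k) polyring" where
  "hom_part d p = (\<Sum>m | m \<in> Poly_Mapping.keys p \<and> int (monom_degree m) = d. Poly_Mapping.single m (lookup p m))"

lemma lookup_hom_part: "lookup (hom_part d p) m = (if int (monom_degree m) = d then lookup p m else 0)"
  by (auto simp: hom_part_def lookup_sum lookup_single when_def in_keys_iff)

lemma hom_part_graded: "hom_part d p \<in> graded_part d"
  by (auto simp: graded_part_def in_keys_iff lookup_hom_part split: if_splits)

lemma hom_part_zero [simp]: "hom_part d 0 = 0"
  by (rule poly_mapping_eqI) (simp add: lookup_hom_part)

lemma hom_part_add: "hom_part d (p + q) = hom_part d p + hom_part d q"
  by (rule poly_mapping_eqI) (simp add: lookup_hom_part lookup_add)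

lemma hom_part_sum: "hom_part d (\<Sum>i\<in>I. g i) = (\<Sum>i\<in>I. hom_part d (g i))"
  by (induction I rule: infinite_finite_induct) (simp_all add: hom_part_add)

text \<open>The difference \<open>r\<close> of \<open>q\<close> and its homogeneous part contributes only terms of other degrees.\<close>

lemma hom_part_mult:
  fixes p q :: "('v::finite, 'k::field) polyring"
  assumes p: "p \<in> graded_part d"
  shows "hom_part e (p * q) = p * hom_part (e - d) q"
proof -
  define r where "r = q - hom_part (e - d) q"
  have "hom_part e (p * hom_part (e - d) q) = p * hom_part (e - d) q"
  proof (rule poly_mapping_eqI)
    fix m
    have "p * hom_part (e - d) q \<in> graded_part e"
      using graded_part_mult[OF p hom_part_graded[of "e - d" q]] by simp
    then show "lookup (hom_part e (p * hom_part (e - d) q)) m = lookup (p * hom_part (e - d) q) m"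
      by (auto simp: lookup_hom_part graded_part_def in_keys_iff)
  qed
  moreover have "hom_part e (p * r) = 0"
  proof (rule poly_mapping_eqI)
    fix m
    have "int (monom_degree m) \<noteq> e" if "m \<in> Poly_Mapping.keys (p * r)"
    proof -
      obtain a b where ab: "m = a + b" "a \<in> Poly_Mapping.keys p" "b \<in> Poly_Mapping.keys r"
        using \<open>m \<in> _\<close> keys_mult by blast
      have "int (monom_degree b) \<noteq> e - d"
        using ab(3) by (auto simp: r_def in_keys_iff lookup_minus lookup_hom_part)
      moreover have "int (monom_degree a) = d" using p ab(2) by (simp add: graded_part_def)
      ultimately show ?thesis by (simp add: ab(1) monom_degree_add)
    qed
    then show "lookup (hom_part e (p * r)) m = lookup 0 m" by (auto simp: lookup_hom_part in_keys_iff)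
  qed
  moreover have "p * q = p * hom_part (e - d) q + p * r" by (simp add: r_def algebra_simps)
  ultimately show ?thesis by (simp add: hom_part_add)
qed

lemma irrelevant_idealI:
  assumes "lookup p 0 = 0"
  shows "p \<in> irrelevant_ideal"
proof -
  have "Poly_Mapping.single m (lookup p m) \<in> irrelevant_ideal" if m: "m \<in> Poly_Mapping.keys p" for m
  proof -
    have "m \<noteq> 0" using assms m by (auto simp: in_keys_iff)
    then obtain z where z: "lookup m z \<noteq> 0" by (metis lookup_zero poly_mapping_eqI)
    have "m = (m - Poly_Mapping.single z 1) + Poly_Mapping.single z 1"
      by (rule poly_mapping_eqI) (use z in \<open>auto simp: lookup_add lookup_minus lookup_single when_def\<close>)
    then have "Poly_Mapping.single m (lookup p m) = Poly_Mapping.single (m - Poly_Mapping.single z 1) (lookup p m) * indet z"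
      by (simp add: indet_def mult_single)
    also have "\<dots> \<in> irrelevant_ideal"
      unfolding irrelevant_ideal_def by (rule ideal_gen_mult_left, rule ideal_gen_base) simp
    finally show ?thesis .
  qed
  then have "(\<Sum>m\<in>Poly_Mapping.keys p. Poly_Mapping.single m (lookup p m)) \<in> irrelevant_ideal"
    unfolding irrelevant_ideal_def by (rule Modules.module.span_sum[OF module_mult])
  then show ?thesis using poly_eq_sum_single[of p] by simp
qed

lemma unit_of_homogeneous:
  fixes p :: "('v::finite, 'k::field) polyring"
  assumes p: "p \<in> graded_part d" and "p \<notin> irrelevant_ideal"
  obtains c where "c \<noteq> 0" "p = Poly_Mapping.single 0 c"
proof (rule that)
  show nz: "lookup p 0 \<noteq> 0" using assms(2) irrelevant_idealI by blast
  have "monom_degree 0 = (0 :: nat)" by (simp add: monom_degree_def)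
  then have d: "d = 0" using p nz by (auto simp: graded_part_def in_keys_iff)
  show "p = Poly_Mapping.single 0 (lookup p 0)"
  proof (rule poly_mapping_eqI)
    fix m
    show "lookup p m = lookup (Poly_Mapping.single 0 (lookup p 0)) m"
    proof (cases "m = 0 \<or> lookup p m = 0")
      case False
      then have "monom_degree m = 0" using p d by (auto simp: graded_part_def in_keys_iff)
      then have "m = 0" by (intro poly_mapping_eqI) (simp add: monom_degree_eq)
      then show ?thesis using False by simp
    qed (auto simp: lookup_single when_def)
  qed
qed

lemma mult_mat_unit_vec:
  fixes A :: "'r::comm_ring_1 mat"
  assumes "A \<in> carrier_mat n m" "b < m"
  shows "A *\<^sub>v unit_vec m b = col A b"
  using assms by (intro eq_vecI) auto

definition vec_fun :: "'r::zero vec \<Rightarrow> nat \<Rightarrow> 'r" where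
  "vec_fun u = (\<lambda>b. if b < dim_vec u then u $ b else 0)"

lemma minimal_homogeneous_generators:
  fixes U :: "(nat \<Rightarrow> ('v::finite, 'k::field) polyring) set"
  assumes U: "submodule U" and gen: "U \<subseteq> submodule_gen (U \<inter> (\<Union>d. hom_vectors D d))"
  obtains G where "finite G" "G \<subseteq> U \<inter> (\<Union>d. hom_vectors D d)" "submodule_gen G = U"
    "\<And>g. g \<in> G \<Longrightarrow> g \<notin> submodule_gen (G - {g})"
proof -
  let ?Hom = "U \<inter> (\<Union>d. hom_vectors D d)"
  define Q where "Q G \<longleftrightarrow> finite G \<and> G \<subseteq> ?Hom \<and> submodule_gen G = U" for G
  obtain G0 where G0: "finite G0" "G0 \<subseteq> ?Hom" "?Hom \<subseteq> submodule_gen G0"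
    by (rule finitely_many_homogeneous_generators[OF U])
  have "submodule_gen G0 = U"
  proof (rule subset_antisym)
    show "submodule_gen G0 \<subseteq> U" using G0(2) by (intro submodule_gen_minimal U) blast
    have "submodule_gen ?Hom \<subseteq> submodule_gen G0"
      by (rule submodule_gen_minimal[OF G0(3) submodule_submodule_gen])
    then show "U \<subseteq> submodule_gen G0" using gen by (rule subset_trans[rotated])
  qed
  then have "Q G0" using G0 by (simp add: Q_def)
  then obtain G where G: "Q G" "\<And>G'. Q G' \<Longrightarrow> card G \<le> card G'"
    using ex_has_least_nat[of Q G0 card] by blast
  have "g \<notin> submodule_gen (G - {g})" if g: "g \<in> G" for g
  proof
    assume red: "g \<in> submodule_gen (G - {g})"
    have "G \<subseteq> submodule_gen (G - {g})"
    proof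
      fix x assume "x \<in> G"
      then show "x \<in> submodule_gen (G - {g})" using red by (cases "x = g") (auto intro: submodule_gen_base)
    qed
    moreover have "G - {g} \<subseteq> submodule_gen G" by (auto intro: submodule_gen_base)
    ultimately have "submodule_gen (G - {g}) = submodule_gen G" by (simp only: submodule_gen_eq)
    then have "Q (G - {g})" using G(1) by (auto simp: Q_def)
    then show False using G(2)[of "G - {g}"] card_Diff1_less[of G g] g G(1) by (simp add: Q_def)
  qed
  then show thesis using that G(1) unfolding Q_def by blast
qed

definition homogeneous_mat :: "int list \<Rightarrow> int list \<Rightarrow> ('v, 'k::field) polyring mat \<Rightarrow> bool" where
  "homogeneous_mat D D' A \<longleftrightarrow> A \<in> carrier_mat (length D) (length D') \<and>
     (\<forall>a<length D. \<forall>b<length D'. A $$ (a, b) \<in> graded_part (D' ! b - D ! a))"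

text \<open>Homogeneous syzygies of the columns have no unit among their entries. By Nakayama this is
minimality of the columns as generators; here it is what makes the next matrix of the resolution minimal.\<close>

definition irredundant_mat :: "int list \<Rightarrow> int list \<Rightarrow> ('v, 'k::field) polyring mat \<Rightarrow> bool" where
  "irredundant_mat D D' A \<longleftrightarrow> (\<forall>w d. w \<in> carrier_vec (length D') \<longrightarrow>
     (\<forall>b<length D'. w $ b \<in> graded_part (d - D' ! b)) \<longrightarrow> A *\<^sub>v w = 0\<^sub>v (length D) \<longrightarrow>
     (\<forall>b<length D'. w $ b \<in> irrelevant_ideal))"

text \<open>The columns of the matrix are minimal homogeneous generators. A unit in a homogeneous syzygy is
a nonzero constant, and it would express one generator by the others.\<close>

lemma minimal_presentation:
  fixes U :: "(nat \<Rightarrow> ('v::finite, 'k::field) polyring) set"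
  assumes U: "submodule U" and gen: "U \<subseteq> submodule_gen (U \<inter> (\<Union>d. hom_vectors D d))"
  obtains D' A where "homogeneous_mat D D' A" "irredundant_mat D D' A"
    "{u \<in> carrier_vec (length D). vec_fun u \<in> U} = (\<lambda>w. A *\<^sub>v w) ` carrier_vec (length D')"
proof -
  obtain G where G: "finite G" "G \<subseteq> U \<inter> (\<Union>d. hom_vectors D d)" "submodule_gen G = U"
    "\<And>g. g \<in> G \<Longrightarrow> g \<notin> submodule_gen (G - {g})"
    using minimal_homogeneous_generators[OF U gen] by blast
  obtain gs where gs: "set gs = G" "distinct gs" using finite_distinct_list[OF G(1)] by blast
  have "\<forall>g\<in>G. \<exists>d. g \<in> hom_vectors D d" using G(2) by blast
  then obtain dg where dg: "\<And>g. g \<in> G \<Longrightarrow> g \<in> hom_vectors D (dg g)" by (rule bchoice[THEN exE]) blast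
  define D' where "D' = map dg gs"
  define A where "A = mat (length D) (length gs) (\<lambda>(a, b). (gs ! b) a)"
  have len [simp]: "length D' = length gs" by (simp add: D'_def)
  have A: "A \<in> carrier_mat (length D) (length gs)" by (simp add: A_def)
  have gs_mem: "gs ! b \<in> G" if "b < length gs" for b using that gs(1) nth_mem by blast
  have A_fun: "vec_fun (A *\<^sub>v w) = (\<Sum>b<length gs. vscale (w $ b) (gs ! b))"
    if w: "w \<in> carrier_vec (length gs)" for w
  proof (rule ext)
    fix a
    show "vec_fun (A *\<^sub>v w) a = (\<Sum>b<length gs. vscale (w $ b) (gs ! b)) a"
    proof (cases "a < length D")
      case True
      then show ?thesis using w
        by (simp add: vec_fun_def A_def sum_fun_apply scalar_prod_def atLeast0LessThan mult.commute)
    next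
      case False
      then have "(gs ! b) a = 0" if "b < length gs" for b
        using dg[OF gs_mem[OF that]] by (simp add: hom_vectors_def)
      then show ?thesis using False by (simp add: vec_fun_def A_def sum_fun_apply)
    qed
  qed
  have vec_fun_inj: "u = v" if "u \<in> carrier_vec n" "v \<in> carrier_vec n" "vec_fun u = vec_fun v" for n and u v :: "('v, 'k) polyring vec"
  proof (rule eq_vecI)
    fix i assume "i < dim_vec v"
    then have "i < dim_vec u" "i < dim_vec v" using that by auto
    moreover have "vec_fun u i = vec_fun v i" using that(3) by simp
    ultimately show "u $ i = v $ i" by (simp add: vec_fun_def)
  qed (use that in simp)
  show thesis
  proof (rule that)
    show "homogeneous_mat D D' A"
      using A dg gs_mem by (auto simp: homogeneous_mat_def A_def D'_def hom_vectors_def)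
    show "{u \<in> carrier_vec (length D). vec_fun u \<in> U} = (\<lambda>w. A *\<^sub>v w) ` carrier_vec (length D')"
    proof (intro subset_antisym subsetI)
      fix u assume "u \<in> {u \<in> carrier_vec (length D). vec_fun u \<in> U}"
      then have u: "u \<in> carrier_vec (length D)" "vec_fun u \<in> submodule_gen G" using G(3) by auto
      then obtain c where c: "vec_fun u = (\<Sum>g\<in>G. vscale (c g) g)"
        unfolding submodule_gen_finite[OF G(1)] by blast
      define w where "w = vec (length gs) (\<lambda>b. c (gs ! b))"
      have "vec_fun (A *\<^sub>v w) = (\<Sum>b<length gs. vscale (c (gs ! b)) (gs ! b))"
        by (subst A_fun) (simp_all add: w_def)
      also have "\<dots> = (\<Sum>g\<in>set gs. vscale (c g) g)"
        by (rule sum.reindex_bij_betw[OF bij_betw_nth[OF gs(2) refl refl]])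
      finally have "vec_fun u = vec_fun (A *\<^sub>v w)" by (simp add: c gs(1))
      then have "u = A *\<^sub>v w"
        by (rule vec_fun_inj[OF u(1) mult_mat_vec_carrier[OF A], rotated]) (simp add: w_def)
      then show "u \<in> (\<lambda>w. A *\<^sub>v w) ` carrier_vec (length D')" by (auto simp: w_def)
    next
      fix u assume "u \<in> (\<lambda>w. A *\<^sub>v w) ` carrier_vec (length D')"
      then obtain w where w: "w \<in> carrier_vec (length gs)" "u = A *\<^sub>v w" by auto
      have "vec_fun u \<in> submodule_gen G"
        unfolding w(2) A_fun[OF w(1)]
        by (intro submodule_gen_sum submodule_gen_scale submodule_gen_base gs_mem) simp
      then show "u \<in> {u \<in> carrier_vec (length D). vec_fun u \<in> U}" using w A G(3) by auto
    qed
    show "irredundant_mat D D' A"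
      unfolding irredundant_mat_def
    proof (intro allI impI, rule ccontr)
      fix w d b
      assume w: "w \<in> carrier_vec (length D')" "\<forall>b<length D'. w $ b \<in> graded_part (d - D' ! b)"
        and ker: "A *\<^sub>v w = 0\<^sub>v (length D)" and b: "b < length D'" and "w $ b \<notin> irrelevant_ideal"
      have "w $ b \<in> graded_part (d - D' ! b)" using w(2) b by blast
      then obtain c where c: "c \<noteq> 0" "w $ b = Poly_Mapping.single 0 c"
        using \<open>w $ b \<notin> irrelevant_ideal\<close> by (rule unit_of_homogeneous)
      let ?c = "Poly_Mapping.single 0 (- inverse c) :: ('v, 'k) polyring"
      define S where "S = (\<Sum>i\<in>{..<length gs} - {b}. vscale (w $ i) (gs ! i))"
      have "(\<Sum>i<length gs. vscale (w $ i) (gs ! i)) = vec_fun (0\<^sub>v (length D))"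
        using A_fun[of w] w(1) ker by simp
      also have "\<dots> = 0" by (auto simp: vec_fun_def fun_eq_iff)
      finally have sum0: "vscale (w $ b) (gs ! b) + S = 0"
        using b by (simp add: S_def sum.remove[of "{..<length gs}" b])
      have "gs ! b = vscale ?c S"
      proof (rule ext)
        fix a
        have "S a = - (Poly_Mapping.single 0 c * (gs ! b) a)"
          using fun_cong[OF sum0, of a] by (simp add: c(2) eq_neg_iff_add_eq_0 add.commute)
        then have "vscale ?c S a = - (?c * Poly_Mapping.single 0 c) * (gs ! b) a" by simp
        also have "- (?c * Poly_Mapping.single 0 c) = 1"
          using c(1) by (simp add: mult_single flip: single_uminus)
        finally show "(gs ! b) a = vscale ?c S a" by simp
      qed
      moreover have "S \<in> submodule_gen (G - {gs ! b})"
        unfolding S_def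
      proof (intro submodule_gen_sum submodule_gen_scale submodule_gen_base)
        fix i assume i: "i \<in> {..<length gs} - {b}"
        then show "gs ! i \<in> G - {gs ! b}"
          using gs_mem b gs(2) by (auto simp: nth_eq_iff_index_eq)
      qed
      ultimately have "gs ! b \<in> submodule_gen (G - {gs ! b})" using submodule_gen_scale by metis
      then show False using G(4) gs_mem b by simp
    qed
  qed
qed

lemma homogeneous_submodule_generated:
  fixes U :: "(nat \<Rightarrow> ('v::finite, 'k::field) polyring) set"
  assumes supp: "\<And>f b. f \<in> U \<Longrightarrow> length D \<le> b \<Longrightarrow> f b = 0"
    and closed: "\<And>f d. f \<in> U \<Longrightarrow> (\<lambda>b. if b < length D then hom_part (d - D ! b) (f b) else 0) \<in> U"
  shows "U \<subseteq> submodule_gen (U \<inter> (\<Union>d. hom_vectors D d))"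
proof
  fix f assume f: "f \<in> U"
  define c where "c d = (\<lambda>b. if b < length D then hom_part (d - D ! b) (f b) else 0)" for d
  define S where "S = (\<Union>b<length D. (\<lambda>m. D ! b + int (monom_degree m)) ` Poly_Mapping.keys (f b))"
  have fin: "finite S" by (simp add: S_def)
  have "f = (\<Sum>d\<in>S. c d)"
  proof (rule ext)
    fix b
    show "f b = (\<Sum>d\<in>S. c d) b"
    proof (cases "b < length D")
      case True
      show ?thesis
      proof (rule poly_mapping_eqI)
        fix m
        have "lookup ((\<Sum>d\<in>S. c d) b) m = (\<Sum>d\<in>S. if d = D ! b + int (monom_degree m) then lookup (f b) m else 0)"
          using True by (auto simp: sum_fun_apply lookup_sum c_def lookup_hom_part intro!: sum.cong)
        also have "\<dots> = (if D ! b + int (monom_degree m) \<in> S then lookup (f b) m else 0)"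
          using fin by (simp add: sum.delta)
        also have "\<dots> = lookup (f b) m"
          using True by (cases "lookup (f b) m = 0") (auto simp: S_def in_keys_iff intro!: bexI[of _ b])
        finally show "lookup (f b) m = lookup ((\<Sum>d\<in>S. c d) b) m" by simp
      qed
    next
      case False
      then show ?thesis using supp[OF f] by (simp add: sum_fun_apply c_def)
    qed
  qed
  moreover have "(\<Sum>d\<in>S. c d) \<in> submodule_gen (U \<inter> (\<Union>d. hom_vectors D d))"
  proof (intro submodule_gen_sum submodule_gen_base IntI)
    fix d
    show "c d \<in> U" unfolding c_def by (rule closed[OF f])
    have "c d \<in> hom_vectors D d" by (auto simp: hom_vectors_def c_def hom_part_graded)
    then show "c d \<in> (\<Union>d. hom_vectors D d)" by blast
  qed
  ultimately show "f \<in> submodule_gen (U \<inter> (\<Union>d. hom_vectors D d))" by simp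
qed

text \<open>The entries of the new matrix lie in the irrelevant ideal because its columns are homogeneous
syzygies of the columns of \<open>A\<close>.\<close>

lemma kernel_presentation:
  fixes A :: "('v::finite, 'k::field) polyring mat"
  assumes A: "homogeneous_mat D0 D A" and irr: "irredundant_mat D0 D A"
  obtains D' B where "homogeneous_mat D D' B" "irredundant_mat D D' B"
    "mat_kernel A = (\<lambda>w. B *\<^sub>v w) ` carrier_vec (length D')"
    "\<And>a b. a < length D \<Longrightarrow> b < length D' \<Longrightarrow> B $$ (a, b) \<in> irrelevant_ideal"
proof -
  define U where "U = {f. (\<forall>b\<ge>length D. f b = 0) \<and> (\<forall>a<length D0. (\<Sum>b<length D. A $$ (a, b) * f b) = 0)}"
  have sub: "submodule U"
  proof (rule submoduleI)
    fix c f assume "f \<in> U"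
    moreover have "(\<Sum>b<length D. A $$ (a, b) * (c * f b)) = c * (\<Sum>b<length D. A $$ (a, b) * f b)" for a
      by (simp add: sum_distrib_left mult_ac)
    ultimately show "vscale c f \<in> U" by (simp add: U_def)
  qed (auto simp: U_def distrib_left sum.distrib)
  have ker: "mat_kernel A = {u \<in> carrier_vec (length D). vec_fun u \<in> U}"
  proof -
    have "A *\<^sub>v u = 0\<^sub>v (dim_row A) \<longleftrightarrow> vec_fun u \<in> U" if "u \<in> carrier_vec (length D)" for u
      using A that
      by (auto simp: homogeneous_mat_def U_def vec_fun_def vec_eq_iff scalar_prod_def atLeast0LessThan)
    then show ?thesis using A by (auto simp: mat_kernel_def homogeneous_mat_def)
  qed
  have "U \<subseteq> submodule_gen (U \<inter> (\<Union>d. hom_vectors D d))"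
  proof (rule homogeneous_submodule_generated)
    fix f d assume f: "f \<in> U"
    have "(\<Sum>b<length D. A $$ (a, b) * hom_part (d - D ! b) (f b)) = 0" if a: "a < length D0" for a
    proof -
      have "(\<Sum>b<length D. A $$ (a, b) * hom_part (d - D ! b) (f b)) =
        (\<Sum>b<length D. hom_part (d - D0 ! a) (A $$ (a, b) * f b))"
      proof (rule sum.cong[OF refl])
        fix b assume "b \<in> {..<length D}"
        then have "A $$ (a, b) \<in> graded_part (D ! b - D0 ! a)" using A a by (simp add: homogeneous_mat_def)
        from hom_part_mult[OF this, of "d - D0 ! a" "f b"]
        show "A $$ (a, b) * hom_part (d - D ! b) (f b) = hom_part (d - D0 ! a) (A $$ (a, b) * f b)" by simp
      qed
      also have "\<dots> = hom_part (d - D0 ! a) (\<Sum>b<length D. A $$ (a, b) * f b)" by (simp add: hom_part_sum)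
      finally show ?thesis using f a by (simp add: U_def)
    qed
    then show "(\<lambda>b. if b < length D then hom_part (d - D ! b) (f b) else 0) \<in> U" by (simp add: U_def)
  qed (simp add: U_def)
  then obtain D' B where B: "homogeneous_mat D D' B" "irredundant_mat D D' B"
    "{u \<in> carrier_vec (length D). vec_fun u \<in> U} = (\<lambda>w. B *\<^sub>v w) ` carrier_vec (length D')"
    by (rule minimal_presentation[OF sub])
  have "B $$ (a, b) \<in> irrelevant_ideal" if a: "a < length D" and b: "b < length D'" for a b
  proof -
    have carrier: "B \<in> carrier_mat (length D) (length D')" using B(1) by (simp add: homogeneous_mat_def)
    have "col B b = B *\<^sub>v unit_vec (length D') b" using carrier b by (simp add: mult_mat_unit_vec)
    then have "col B b \<in> mat_kernel A" unfolding ker B(3) by auto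
    then have "A *\<^sub>v col B b = 0\<^sub>v (length D0)" using A by (auto simp: mat_kernel_def homogeneous_mat_def)
    moreover have "\<forall>i<length D. col B b $ i \<in> graded_part (D' ! b - D ! i)"
      using B(1) b carrier by (simp add: homogeneous_mat_def)
    moreover have "col B b \<in> carrier_vec (length D)" using carrier b by auto
    ultimately have "col B b $ a \<in> irrelevant_ideal" using irr a unfolding irredundant_mat_def by blast
    then show ?thesis using carrier a b by simp
  qed
  then show thesis using that B ker by simp
qed

text \<open>The resolution starts with $F_0 = S$. The ideal is presented by minimal generators, and
\<open>kernel_presentation\<close> is iterated; a state of the iteration consists of two lists of
degrees and the matrix between them.\<close>

theorem minimal_graded_free_resolution_exists:
  fixes I :: "('v::finite, 'k::field) polyring set"
  assumes ideal: "Modules.module.subspace (*) I" and proper: "I \<subseteq> irrelevant_ideal"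
    and hom: "\<And>p d. p \<in> I \<Longrightarrow> hom_part d p \<in> I"
  shows "\<exists>D \<epsilon> \<phi>. minimal_graded_free_resolution I D \<epsilon> \<phi>"
proof -
  define U where "U = {f :: nat \<Rightarrow> ('v, 'k) polyring. (\<forall>b\<ge>1. f b = 0) \<and> f 0 \<in> I}"
  have sub: "submodule U"
    using ideal by (auto simp: U_def Modules.module.subspace_def[OF module_mult] intro!: submoduleI)
  have "U \<subseteq> submodule_gen (U \<inter> (\<Union>d. hom_vectors [0] d))"
    by (rule homogeneous_submodule_generated) (auto simp: U_def hom)
  then obtain D1 A where A: "homogeneous_mat [0] D1 A" "irredundant_mat [0] D1 A"
    "{u \<in> carrier_vec (length [0::int]). vec_fun u \<in> U} = (\<lambda>w. A *\<^sub>v w) ` carrier_vec (length D1)"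
    by (rule minimal_presentation[OF sub])
  define good where "good x \<longleftrightarrow> (case x of (D, D', A) \<Rightarrow> homogeneous_mat D D' A \<and> irredundant_mat D D' A)"
    for x :: "int list \<times> int list \<times> ('v, 'k) polyring mat"
  define step where "step x y \<longleftrightarrow> (case (x, y) of ((D, D', A), (E, E', B)) \<Rightarrow> E = D' \<and>
      mat_kernel A = (\<lambda>w. B *\<^sub>v w) ` carrier_vec (length E') \<and>
      (\<forall>a<length E. \<forall>b<length E'. B $$ (a, b) \<in> irrelevant_ideal))"
    for x y :: "int list \<times> int list \<times> ('v, 'k) polyring mat"
  have "\<exists>f. \<forall>n. (good (f n) \<and> (n = 0 \<longrightarrow> f n = ([0], D1, A))) \<and> step (f n) (f (Suc n))"
  proof (rule dependent_nat_choice)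
    show "\<exists>x. good x \<and> ((0::nat) = 0 \<longrightarrow> x = ([0], D1, A))" using A by (simp add: good_def)
  next
    fix x and n :: nat
    assume x: "good x \<and> (n = 0 \<longrightarrow> x = ([0], D1, A))"
    obtain D D' M where x_eq: "x = (D, D', M)" by (cases x)
    obtain D'' B where "homogeneous_mat D' D'' B" "irredundant_mat D' D'' B"
      "mat_kernel M = (\<lambda>w. B *\<^sub>v w) ` carrier_vec (length D'')"
      "\<And>a b. a < length D' \<Longrightarrow> b < length D'' \<Longrightarrow> B $$ (a, b) \<in> irrelevant_ideal"
      by (rule kernel_presentation[of D D' M]) (use x in \<open>auto simp: x_eq good_def\<close>)
    then show "\<exists>y. (good y \<and> (Suc n = 0 \<longrightarrow> y = ([0], D1, A))) \<and> step x y"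
      by (intro exI[of _ "(D', D'', B)"]) (simp add: x_eq good_def step_def)
  qed
  then obtain f where f': "\<forall>n. (good (f n) \<and> (n = 0 \<longrightarrow> f n = ([0], D1, A))) \<and> step (f n) (f (Suc n))"
    by (elim exE)
  have f: "good (f n)" "f 0 = ([0], D1, A)" "step (f n) (f (Suc n))" for n
    using f' by simp_all
  define D where "D n = fst (f n)" for n
  define \<phi> where "\<phi> n = snd (snd (f n))" for n
  have D_Suc: "fst (snd (f n)) = D (Suc n)" for n
    using f(3)[of n] by (simp add: step_def D_def split: prod.splits)
  have f_eq: "f n = (D n, D (Suc n), \<phi> n)" for n
    unfolding D_Suc[symmetric] by (simp add: D_def \<phi>_def)
  have 0: "D 0 = [0]" "D 1 = D1" "\<phi> 0 = A" using f(2) f_eq[of 0] by simp_all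
  have hom_\<phi>: "homogeneous_mat (D n) (D (Suc n)) (\<phi> n)" for n
    using f(1)[of n] by (simp add: good_def f_eq)
  have ker_\<phi>: "mat_kernel (\<phi> n) = (\<lambda>w. \<phi> (Suc n) *\<^sub>v w) ` carrier_vec (length (D (Suc (Suc n))))" for n
    using f(3)[of n] by (simp add: step_def f_eq)
  define \<epsilon> where "\<epsilon> = vec 1 (\<lambda>_. 1 :: ('v, 'k) polyring)"
  have \<epsilon>_prod: "\<epsilon> \<bullet> u = u $ 0" if "u \<in> carrier_vec 1" for u
    using that by (simp add: \<epsilon>_def scalar_prod_def)
  have vec_U: "vec_fun u \<in> U \<longleftrightarrow> u $ 0 \<in> I" if "u \<in> carrier_vec 1" for u
    using that by (auto simp: vec_fun_def U_def)
  have ker_\<epsilon>: "{u \<in> carrier_vec (length (D 0)). \<epsilon> \<bullet> u \<in> I} = (\<lambda>w. \<phi> 0 *\<^sub>v w) ` carrier_vec (length (D 1))"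
    unfolding 0 A(3)[symmetric] by (intro Collect_cong conj_cong refl) (simp add: \<epsilon>_prod vec_U)
  have irr: "\<phi> n $$ (a, b) \<in> irrelevant_ideal" if a: "a < length (D n)" and b: "b < length (D (Suc n))" for n a b
  proof (cases n)
    case (Suc m)
    then show ?thesis using f(3)[of m] a b by (simp add: step_def f_eq)
  next
    case n: 0
    have carrier: "\<phi> 0 \<in> carrier_mat 1 (length (D 1))" using hom_\<phi>[of 0] by (simp add: homogeneous_mat_def 0)
    have "col (\<phi> 0) b = \<phi> 0 *\<^sub>v unit_vec (length (D 1)) b"
      using carrier b n by (simp add: mult_mat_unit_vec)
    then have "col (\<phi> 0) b \<in> (\<lambda>w. \<phi> 0 *\<^sub>v w) ` carrier_vec (length (D 1))" by auto
    then have "col (\<phi> 0) b $ 0 \<in> I"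
      unfolding ker_\<epsilon>[symmetric] by (auto simp: \<epsilon>_prod 0(1))
    then have "\<phi> 0 $$ (0, b) \<in> I" using carrier b n by simp
    then show ?thesis using proper a n by (auto simp: 0)
  qed
  have "1 \<in> (graded_part 0 :: ('v, 'k) polyring set)"
    by (simp add: graded_part_def monom_degree_def)
  have "\<exists>u\<in>carrier_vec (length (D 0)). p - \<epsilon> \<bullet> u \<in> I" for p
  proof (rule bexI[of _ "vec 1 (\<lambda>_. p)"])
    show "p - \<epsilon> \<bullet> vec 1 (\<lambda>_. p) \<in> I"
      using ideal by (simp add: \<epsilon>_prod Modules.module.subspace_def[OF module_mult])
  qed (simp add: 0)
  moreover have "\<epsilon> \<in> carrier_vec (length (D 0))" "\<forall>b<length (D 0). \<epsilon> $ b \<in> graded_part (D 0 ! b)"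
    using \<open>1 \<in> graded_part 0\<close> by (simp_all add: 0(1) \<epsilon>_def)
  ultimately have "minimal_graded_free_resolution I D \<epsilon> \<phi>"
    unfolding minimal_graded_free_resolution_def
    using hom_\<phi>[unfolded homogeneous_mat_def] ker_\<phi> ker_\<epsilon> irr by (intro conjI allI impI) simp_all
  then show ?thesis by blast
qed

section \<open>The regularity of the whisker graph\<close>

lemma lift_columns:
  fixes A :: "'r::comm_ring_1 mat"
  assumes A: "A \<in> carrier_mat r n" and U: "U \<in> carrier_mat r m"
    and cols: "\<And>j. j < m \<Longrightarrow> col U j \<in> (\<lambda>w. A *\<^sub>v w) ` carrier_vec n"
  shows "\<exists>W\<in>carrier_mat n m. U = A * W"
proof -
  have "\<forall>j\<in>{..<m}. \<exists>w. w \<in> carrier_vec n \<and> col U j = A *\<^sub>v w"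
    using cols by auto
  then obtain w where w: "\<forall>j\<in>{..<m}. w j \<in> carrier_vec n \<and> col U j = A *\<^sub>v w j"
    by (rule bchoice[THEN exE])
  define W where "W = mat n m (\<lambda>(i, j). w j $ i)"
  have W: "W \<in> carrier_mat n m" by (simp add: W_def)
  have "U = A * W"
  proof (rule eq_matI)
    fix i j assume "i < dim_row (A * W)" "j < dim_col (A * W)"
    then have ij: "i < r" "j < m" using A W by auto
    then have wj: "w j \<in> carrier_vec n" "col U j = A *\<^sub>v w j" using w by auto
    have "col W j = w j" using wj(1) ij by (intro eq_vecI) (auto simp: W_def)
    then have "(A * W) $$ (i, j) = (A *\<^sub>v w j) $ i" using A W ij by simp
    also have "\<dots> = col U j $ i" by (simp add: wj(2))
    also have "\<dots> = U $$ (i, j)" using U ij by simp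
    finally show "U $$ (i, j) = (A * W) $$ (i, j)" by simp
  qed (use A U W in auto)
  then show ?thesis using W by blast
qed

lemma edge_binomial_graded:
  fixes i j :: "'a::finite"
  shows "edge_binomial i j \<in> graded_part 2"
proof -
  have "indet a * indet b \<in> graded_part 2" for a b :: "'a var"
    using graded_part_mult[OF indet_graded[of a] indet_graded[of b]] by simp
  then show ?thesis unfolding edge_binomial_def by (intro graded_part_diff)
qed

lemma hom_part_binomial_edge_ideal:
  fixes p :: "('v::{finite,linorder}, 'k::field) polyring"
  assumes "p \<in> binomial_edge_ideal H"
  shows "hom_part d p \<in> binomial_edge_ideal H"
  using assms unfolding binomial_edge_ideal_def
proof (induction arbitrary: d rule: ideal_gen_induct)
  case (step c x y)
  then obtain i j where "x = edge_binomial i j" by blast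
  then have "hom_part d (c * x + y) = hom_part (d - 2) c * x + hom_part d y"
    using hom_part_mult[OF edge_binomial_graded, of d i j c] by (simp add: hom_part_add mult.commute)
  then show ?case
    using step.IH[of d] step.hyps by (simp only: ideal_gen_add ideal_gen_mult_left ideal_gen_base)
qed (simp add: ideal_gen_zero)

lemma binomial_edge_ideal_subset_irrelevant_ideal:
  fixes H :: "'v::linorder set set"
  shows "(binomial_edge_ideal H :: ('v, 'k::field) polyring set) \<subseteq> irrelevant_ideal"
proof
  fix p :: "('v, 'k) polyring"
  have edge: "edge_binomial i j \<in> (irrelevant_ideal :: ('v, 'k) polyring set)" for i j
  proof (rule irrelevant_idealI)
    show "lookup (edge_binomial i j :: ('v, 'k) polyring) 0 = 0"
    proof -
      have "Poly_Mapping.single a (1::nat) + b \<noteq> 0" for a :: "'v var" and b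
      proof
        assume "Poly_Mapping.single a 1 + b = 0"
        then have "lookup (Poly_Mapping.single a 1 + b) a = 0" by simp
        then show False by (simp add: lookup_add)
      qed
      then show ?thesis unfolding edge_binomial_eq lookup_minus lookup_single by (simp only: when_simps diff_self)
    qed
  qed
  assume "p \<in> binomial_edge_ideal H"
  then show "p \<in> irrelevant_ideal"
    unfolding binomial_edge_ideal_def
  proof (induction rule: ideal_gen_induct)
    case base
    show ?case by (simp add: irrelevant_ideal_def ideal_gen_zero)
  next
    case (step c x y)
    then have "x \<in> irrelevant_ideal" using edge by blast
    then show ?case using step.IH unfolding irrelevant_ideal_def by (simp only: ideal_gen_add ideal_gen_mult_left)
  qed
qed

text \<open>The cocycle of degree $-2n$ on $F_n$ is in particular not zero, so it has a nonzero entry, whose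
degree $D_{n,b} - 2n$ cannot be negative.\<close>

lemma resolution_has_large_degree:
  fixes E :: "'a::{finite,linorder} set set"
  assumes res: "minimal_graded_free_resolution
    (binomial_edge_ideal (whisker_graph E) :: ('a whisker_vertex, 'k::field) polyring set) D \<epsilon> \<phi>"
  shows "\<exists>j\<in>set (D (CARD('a))). 2 * int (CARD('a)) \<le> j"
proof -
  let ?J = "binomial_edge_ideal (whisker_graph E) :: ('a whisker_vertex, 'k) polyring set"
  let ?n = "CARD('a)"
  note res1 = res[unfolded minimal_graded_free_resolution_def]
  note res2 = res1[THEN conjunct2]
  note res3 = res2[THEN conjunct2]
  note res4 = res3[THEN conjunct2]
  note res5 = res4[THEN conjunct2]
  note res6 = res5[THEN conjunct2]
  note res7 = res6[THEN conjunct2]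
  have \<epsilon>: "\<epsilon> \<in> carrier_vec (length (D 0))"
    by (rule res1[THEN conjunct1])
  have \<phi>: "\<phi> i \<in> carrier_mat (length (D i)) (length (D (Suc i)))" for i
    by (rule res2[THEN conjunct1, rule_format])
  have \<epsilon>_deg: "b < length (D 0) \<Longrightarrow> \<epsilon> $ b \<in> graded_part (D 0 ! b)" for b
    by (rule res3[THEN conjunct1, rule_format])
  have \<phi>_deg: "a < length (D i) \<Longrightarrow> b < length (D (Suc i)) \<Longrightarrow>
      \<phi> i $$ (a, b) \<in> graded_part (D (Suc i) ! b - D i ! a)" for i a b
    by (rule res4[THEN conjunct1, rule_format])
  have surj: "\<exists>u\<in>carrier_vec (length (D 0)). p - \<epsilon> \<bullet> u \<in> ?J" for p
    by (rule res5[THEN conjunct1, rule_format])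
  have ker_\<epsilon>: "{u \<in> carrier_vec (length (D 0)). \<epsilon> \<bullet> u \<in> ?J} = (\<lambda>w. \<phi> 0 *\<^sub>v w) ` carrier_vec (length (D 1))"
    by (rule res6[THEN conjunct1])
  have ker_\<phi>: "mat_kernel (\<phi> i) = (\<lambda>w. \<phi> (Suc i) *\<^sub>v w) ` carrier_vec (length (D (Suc (Suc i))))" for i
    by (rule res7[THEN conjunct1, rule_format])
  define rk where "rk k = (case k of 0 \<Rightarrow> 0 | Suc l \<Rightarrow> length (D l))" for k
  define \<psi> where "\<psi> k = (case k of 0 \<Rightarrow> 0\<^sub>m 0 (length (D 0)) | Suc l \<Rightarrow> \<phi> l)" for k
  have rk [simp]: "rk 0 = 0" "rk (Suc l) = length (D l)" for l by (simp_all add: rk_def)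
  have \<psi> [simp]: "\<psi> 0 = 0\<^sub>m 0 (length (D 0))" "\<psi> (Suc l) = \<phi> l" for l by (simp_all add: \<psi>_def)
  have kernel: "U \<in> carrier_mat (length (D (Suc k))) m \<Longrightarrow> \<phi> k * U = 0\<^sub>m (length (D k)) m \<Longrightarrow> j < m \<Longrightarrow>
      col U j \<in> mat_kernel (\<phi> k)" for U k m j
  proof (rule mat_kernelI[OF \<phi>])
    assume U: "U \<in> carrier_mat (length (D (Suc k))) m" "\<phi> k * U = 0\<^sub>m (length (D k)) m" "j < m"
    show "col U j \<in> carrier_vec (length (D (Suc k)))" using U by auto
    have "\<phi> k *\<^sub>v col U j = col (\<phi> k * U) j" by (rule col_mult2[OF \<phi> U(1,3), symmetric])
    also have "\<dots> = 0\<^sub>v (length (D k))" unfolding U(2) using U(3) by simp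
    finally show "\<phi> k *\<^sub>v col U j = 0\<^sub>v (length (D k))" .
  qed
  have image: "col (\<phi> k) j \<in> (\<lambda>w. \<phi> k *\<^sub>v w) ` carrier_vec (length (D (Suc k)))"
    if "j < length (D (Suc k))" for j k
    using mult_mat_unit_vec[OF \<phi> that] by (metis image_eqI unit_vec_carrier)
  interpret whisker_complex E rk \<psi>
  proof
    show "rk 0 = 0" by simp
    show "\<psi> k \<in> carrier_mat (rk k) (rk (Suc k))" for k using \<phi> by (cases k) simp_all
    show "\<psi> k * \<psi> (Suc k) = 0\<^sub>m (rk k) (rk (Suc (Suc k)))" for k
    proof (cases k)
      case 0
      then show ?thesis using \<phi>[of 0] by (intro eq_matI) auto
    next
      case (Suc l)
      have "\<phi> l * \<phi> (Suc l) = 0\<^sub>m (length (D l)) (length (D (Suc (Suc l))))"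
      proof (rule mat_col_eqI)
        fix j assume "j < dim_col (0\<^sub>m (length (D l)) (length (D (Suc (Suc l)))))"
        then have j: "j < length (D (Suc (Suc l)))" by simp
        have "col (\<phi> l * \<phi> (Suc l)) j = \<phi> l *\<^sub>v col (\<phi> (Suc l)) j"
          by (rule col_mult2[OF \<phi> \<phi> j])
        also have "\<dots> = 0\<^sub>v (length (D l))"
          using image[OF j] unfolding ker_\<phi>[symmetric] by (rule mat_kernelD(2)[OF \<phi>])
        finally show "col (\<phi> l * \<phi> (Suc l)) j = col (0\<^sub>m (length (D l)) (length (D (Suc (Suc l))))) j"
          using j by simp
      qed (use \<phi>[of l] \<phi>[of "Suc l"] in auto)
      then show ?thesis by (simp add: Suc)
    qed
    show "\<exists>W\<in>carrier_mat (rk (Suc (Suc (Suc k)))) m. U = \<psi> (Suc (Suc k)) * W"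
      if U: "U \<in> carrier_mat (rk (Suc (Suc k))) m" "\<psi> (Suc k) * U = 0\<^sub>m (rk (Suc k)) m" for U k m
      unfolding rk \<psi>
    proof (rule lift_columns[OF \<phi>])
      fix j assume "j < m"
      then show "col U j \<in> (\<lambda>w. \<phi> (Suc k) *\<^sub>v w) ` carrier_vec (length (D (Suc (Suc k))))"
        using kernel[of U k m j] U unfolding ker_\<phi> by simp
    qed (use U in simp)
    show "\<exists>W\<in>carrier_mat (rk 2) (rk 1). \<psi> 1 * W = a \<cdot>\<^sub>m 1\<^sub>m (rk 1)" if a: "a \<in> ?J" for a
    proof -
      let ?U = "a \<cdot>\<^sub>m 1\<^sub>m (length (D 0)) :: ('a whisker_vertex, 'k) polyring mat"
      have "\<exists>W\<in>carrier_mat (length (D (Suc 0))) (length (D 0)). ?U = \<phi> 0 * W"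
      proof (rule lift_columns[OF \<phi>])
        fix j assume j: "j < length (D 0)"
        have "\<epsilon> \<bullet> col ?U j = (\<epsilon> $ j) * a"
        proof -
          have "\<epsilon> \<bullet> col ?U j = (\<Sum>i\<in>{0..<length (D 0)}. \<epsilon> $ i * (if i = j then a else 0))"
            using \<epsilon> j by (auto simp: scalar_prod_def intro!: sum.cong)
          then show ?thesis using j by (simp add: if_distrib sum.delta cong: if_cong)
        qed
        also have "\<dots> \<in> ?J" by (rule binomial_edge_ideal_mult_left[OF a])
        finally have "col ?U j \<in> {u \<in> carrier_vec (length (D 0)). \<epsilon> \<bullet> u \<in> ?J}" using j by auto
        then show "col ?U j \<in> (\<lambda>w. \<phi> 0 *\<^sub>v w) ` carrier_vec (length (D (Suc 0)))"
          unfolding ker_\<epsilon> by simp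
      qed simp
      then show ?thesis by (metis One_nat_def numeral_2_eq_2 rk(2) \<psi>(2))
    qed
  qed
  define e where "e = mat 1 (length (D 0)) (\<lambda>(_, b). \<epsilon> $ b)"
  have e: "e \<in> carrier_mat 1 (rk 1)" by (simp add: e_def)
  have row_e: "row e 0 = \<epsilon>" using \<epsilon> by (intro eq_vecI) (auto simp: e_def)
  have J_mq: "p \<in> monomial_quotient_ideal UNIV" if "p \<in> ?J" for p
    by (rule binomial_edge_ideal_subset_mq[OF that])
  have "mq_mat UNIV (e * \<psi> 1)"
    unfolding entries_in_def
  proof (intro allI impI)
    fix i j assume ij: "i < dim_row (e * \<psi> 1)" "j < dim_col (e * \<psi> 1)"
    then have j: "j < length (D (Suc 0))" and i: "i = 0" using e \<phi>[of 0] by auto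
    have "col (\<phi> 0) j \<in> {u \<in> carrier_vec (length (D 0)). \<epsilon> \<bullet> u \<in> ?J}"
      unfolding ker_\<epsilon> using image[OF j] by simp
    then have "\<epsilon> \<bullet> col (\<phi> 0) j \<in> ?J" by simp
    moreover have "(e * \<psi> 1) $$ (i, j) = \<epsilon> \<bullet> col (\<phi> 0) j" using ij i row_e by simp
    ultimately show "(e * \<psi> 1) $$ (i, j) \<in> monomial_quotient_ideal UNIV" using J_mq by simp
  qed
  moreover have "\<not> mq_mat UNIV e"
  proof
    assume *: "mq_mat UNIV e"
    obtain u where u: "u \<in> carrier_vec (length (D 0))" "1 - \<epsilon> \<bullet> u \<in> ?J" using surj[of 1] by blast
    have "\<epsilon> $ i \<in> monomial_quotient_ideal UNIV" if "i < length (D 0)" for i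
      using * that by (auto simp: entries_in_def e_def)
    then have "\<epsilon> \<bullet> u \<in> monomial_quotient_ideal UNIV"
      using u(1) \<epsilon> unfolding scalar_prod_def by (intro mq_sum mq_mult_right) auto
    from mq_add[OF J_mq[OF u(2)] this] show False by (simp add: one_notin_mq)
  qed
  ultimately have "\<exists>A s. card (- A) = ?n \<and> s \<in> carrier_mat 1 (rk (Suc ?n)) \<and>
    (\<forall>b<rk (Suc ?n). s $$ (0, b) \<in> graded_part (D ?n ! b - 2 * int ?n)) \<and> mq_mat A (s * \<psi> (Suc ?n)) \<and>
    \<not> (\<exists>t\<in>carrier_mat 1 (rk ?n). mq_mat A (s - t * \<psi> ?n))"
    using \<phi>_deg \<epsilon>_deg by (intro nontrivial_cocycle[OF _ e, of "\<lambda>k b. D k ! b"]) (auto simp: e_def)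
  then obtain A s where s: "s \<in> carrier_mat 1 (rk (Suc ?n))"
    and s_deg: "\<And>b. b < rk (Suc ?n) \<Longrightarrow> s $$ (0, b) \<in> graded_part (D ?n ! b - 2 * int ?n)"
    and nontrivial: "\<not> (\<exists>t\<in>carrier_mat 1 (rk ?n). mq_mat A (s - t * \<psi> ?n))" by auto
  have "\<exists>b<rk (Suc ?n). s $$ (0, b) \<noteq> 0"
  proof (rule ccontr)
    assume "\<not> ?thesis"
    then have "s = 0\<^sub>m 1 (rk (Suc ?n))" using s by (intro eq_matI) auto
    then have "s - 0\<^sub>m 1 (rk ?n) * \<psi> ?n = 0\<^sub>m 1 (rk (Suc ?n))"
      using \<psi>_carrier[of ?n] by (intro eq_matI) auto
    then have "mq_mat A (s - 0\<^sub>m 1 (rk ?n) * \<psi> ?n)" by (simp only: mq_mat_zero)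
    then show False using nontrivial zero_carrier_mat by blast
  qed
  then obtain b where b: "b < rk (Suc ?n)" "s $$ (0, b) \<noteq> 0" by blast
  then obtain m where "m \<in> Poly_Mapping.keys (s $$ (0, b))" by (auto simp flip: keys_eq_empty)
  then have "int (monom_degree m) = D ?n ! b - 2 * int ?n"
    using s_deg[OF b(1)] by (simp add: graded_part_def)
  then have "2 * int ?n \<le> D ?n ! b" by linarith
  then show ?thesis using b(1) by auto
qed

theorem corollary4p8:
  fixes E :: "'a::{finite,linorder} set set"
  assumes "simple_graph E"
  shows "((\<forall>i. \<not> isolated_vertex E i) \<longrightarrow> v_empty TYPE('k::field) (whisker_graph E) = CARD('a)) \<and>
    ereal (real CARD('a)) \<le>
      reg_quotient (binomial_edge_ideal (whisker_graph E) :: ('a whisker_vertex, 'k) polyring set)"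
proof (intro conjI impI)
  assume "\<forall>i. \<not> isolated_vertex E i"
  then show "v_empty TYPE('k) (whisker_graph E) = CARD('a)"
    by (intro v_empty_whisker_graph[OF assms]) blast
next
  let ?J = "binomial_edge_ideal (whisker_graph E) :: ('a whisker_vertex, 'k) polyring set"
  let ?n = "CARD('a)"
  define D where "D = (SOME D. \<exists>\<epsilon> \<phi>. minimal_graded_free_resolution ?J D \<epsilon> \<phi>)"
  have "\<exists>D \<epsilon> \<phi>. minimal_graded_free_resolution ?J D \<epsilon> \<phi>"
  proof (rule minimal_graded_free_resolution_exists)
    show "Modules.module.subspace (*) ?J"
      unfolding binomial_edge_ideal_def by (rule Modules.module.subspace_span[OF module_mult])
  qed (simp_all add: binomial_edge_ideal_subset_irrelevant_ideal hom_part_binomial_edge_ideal)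
  then have "\<exists>\<epsilon> \<phi>. minimal_graded_free_resolution ?J D \<epsilon> \<phi>"
    unfolding D_def by (rule someI_ex)
  then obtain j where j: "j \<in> set (D ?n)" "2 * int ?n \<le> j"
    using resolution_has_large_degree by blast
  have "graded_betti ?J ?n j \<noteq> 0"
    using j(1) by (simp add: graded_betti_def count_list_0_iff flip: D_def)
  then have "ereal (real_of_int (j - int ?n)) \<le> reg_quotient ?J"
    unfolding reg_quotient_def by (intro SUP_upper2[of "(?n, j)"]) auto
  moreover have "real ?n \<le> real_of_int (j - int ?n)" using j(2) by linarith
  ultimately show "ereal (real ?n) \<le> reg_quotient ?J"
    by (meson ereal_less_eq(3) order_trans)
qed

end
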